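(* Let $G\in\mathbb{G}_{n,\gamma}$ attain the minimum spectral radius among all graphs in $\mathbb{G}_{n,\gamma}$. Then: if $\gamma=1$, $G\cong S_n$; if $\gamma=2$ (and $n\ge 4$), $G\cong H_{\lfloor n/2\rfloor,\lceil n/2\rceil}$; if $\gamma=\lceil n/3\rceil$, $G\cong P_n$.
   Context: All graphs are simple, finite, undirected. The domination number $\gamma(G)$ is the minimum size of a set $D\subseteq V(G)$ such that every vertex outside $D$ is adjacent to a vertex of $D$. $\mathbb{G}_{n,\gamma}$ is the set of simple connected graphs on $n$ vertices with domination number $\gamma$; the spectral radius is the largest adjacency eigenvalue. $S_n$ and $P_n$ are the star and path on $n$ vertices. $H_{\lfloor n/2\rfloor,\lceil n/2\rceil}$ is the graph obtained from a path $v_1v_2v_3v_4$ by attaching $\lfloor n/2\rfloor-2$ pendent edges at $v_1$ and $\lceil n/2\rceil-2$ pendent edges at $v_4$. *)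

theory Defs
  imports
    "Graph_Theory.Graph_Theory"
    "Jordan_Normal_Form.Spectral_Radius"
begin

text \<open>
  A finite simple undirected graph is a \<open>pair_graph\<close>: a finite, loop-free, symmetric digraph
  whose arcs are ordered pairs of vertices, so that an edge \<open>uv\<close> is present as both
  \<open>(u, v)\<close> and \<open>(v, u)\<close>.
\<close>

definition dominating_set :: "'a pair_pre_digraph \<Rightarrow> 'a set \<Rightarrow> bool" where
  "dominating_set G D \<longleftrightarrow>
     D \<subseteq> pverts G \<and> (\<forall>v \<in> pverts G - D. \<exists>u \<in> D. (u, v) \<in> parcs G)"

definition domination_number :: "'a pair_pre_digraph \<Rightarrow> nat" where
  "domination_number G = Min (card ` {D. dominating_set G D})"

text \<open>
  Matrices are indexed by natural numbers, so the vertices have to be enumerated; the set of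
  eigenvalues does not depend on the enumeration, see \<open>eigenvalue_adjacency_matrix_iff\<close> below.
\<close>

definition vertex_list :: "'a pair_pre_digraph \<Rightarrow> 'a list" where
  "vertex_list G = (SOME vs. distinct vs \<and> set vs = pverts G)"

definition adjacency_matrix :: "'a pair_pre_digraph \<Rightarrow> real mat" where
  "adjacency_matrix G =
     mat (card (pverts G)) (card (pverts G))
       (\<lambda>(i, j). if (vertex_list G ! i, vertex_list G ! j) \<in> parcs G then 1 else 0)"

definition graph_spectral_radius :: "'a pair_pre_digraph \<Rightarrow> real" where
  "graph_spectral_radius G = Max {l. eigenvalue (adjacency_matrix G) l}"

definition graphs_order_domination :: "nat \<Rightarrow> nat \<Rightarrow> 'a pair_pre_digraph set" where
  "graphs_order_domination n d =
     {G. pair_graph G \<and> Digraph_Component.connected (with_proj G) \<and>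
         card (pverts G) = n \<and> domination_number G = d}"

definition graph_isomorphic :: "'a pair_pre_digraph \<Rightarrow> 'b pair_pre_digraph \<Rightarrow> bool" where
  "graph_isomorphic G H \<longleftrightarrow> digraph_iso (with_proj G) (with_proj H)"

definition star_graph :: "nat \<Rightarrow> nat pair_pre_digraph" where
  "star_graph n =
     (let E = {(0, i) | i. 1 \<le> i \<and> i < n}
      in \<lparr>pverts = {..<n}, parcs = E \<union> E\<inverse>\<rparr>)"

definition path_graph :: "nat \<Rightarrow> nat pair_pre_digraph" where
  "path_graph n =
     (let E = {(i, Suc i) | i. Suc i < n}
      in \<lparr>pverts = {..<n}, parcs = E \<union> E\<inverse>\<rparr>)"

text \<open>
  In the graph \<open>H\<^bsub>a,b\<^esub>\<close> the path \<open>v\<^sub>1 v\<^sub>2 v\<^sub>3 v\<^sub>4\<close> is \<open>0, 1, 2, 3\<close>; the \<open>a - 2\<close> vertices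
  \<open>4, \<dots>, a + 1\<close> are pendent at \<open>v\<^sub>1\<close> and the \<open>b - 2\<close> vertices \<open>a + 2, \<dots>, a + b - 1\<close> are
  pendent at \<open>v\<^sub>4\<close>. Only meaningful for \<open>a, b \<ge> 2\<close>.
\<close>

definition H_graph :: "nat \<Rightarrow> nat \<Rightarrow> nat pair_pre_digraph" where
  "H_graph a b =
     (let E = {(0, 1), (1, 2), (2, 3)} \<union> {0} \<times> {4..<a + 2} \<union> {3} \<times> {a + 2..<a + b}
      in \<lparr>pverts = {..<a + b}, parcs = E \<union> E\<inverse>\<rparr>)"

lemma pair_graph_symI:
  assumes "finite V" "E \<subseteq> V \<times> V" "\<And>v. (v, v) \<notin> E"
  shows "pair_graph \<lparr>pverts = V, parcs = E \<union> E\<inverse>\<rparr>"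
proof -
  have "finite E" using assms by (meson finite_SigmaI finite_subset)
  then show ?thesis
    using assms by unfold_locales (auto simp: symmetric_def sym_def)
qed

lemma pair_graph_star_graph: "pair_graph (star_graph n)"
  unfolding star_graph_def Let_def by (rule pair_graph_symI) auto

lemma pair_graph_path_graph: "pair_graph (path_graph n)"
  unfolding path_graph_def Let_def by (rule pair_graph_symI) auto

lemma pair_graph_H_graph: "2 \<le> a \<Longrightarrow> 2 \<le> b \<Longrightarrow> pair_graph (H_graph a b)"
  unfolding H_graph_def Let_def by (rule pair_graph_symI) auto

lemma vertex_list:
  assumes "finite (pverts G)"
  shows "distinct (vertex_list G)" "set (vertex_list G) = pverts G"
    "length (vertex_list G) = card (pverts G)"
proof -
  have "\<exists>vs. distinct vs \<and> set vs = pverts G"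
    using finite_distinct_list[OF assms] by blast
  then have *: "distinct (vertex_list G) \<and> set (vertex_list G) = pverts G"
    unfolding vertex_list_def by (rule someI_ex)
  then show "distinct (vertex_list G)" "set (vertex_list G) = pverts G" by auto
  then show "length (vertex_list G) = card (pverts G)" by (metis distinct_card)
qed

lemma eigenvalue_adjacency_matrix_iff:
  assumes fin: "finite (pverts G)" and wf: "parcs G \<subseteq> pverts G \<times> pverts G"
  shows "eigenvalue (adjacency_matrix G) l \<longleftrightarrow>
    (\<exists>f. (\<exists>v \<in> pverts G. f v \<noteq> 0) \<and>
         (\<forall>v \<in> pverts G. (\<Sum>u | (v, u) \<in> parcs G. f u) = l * f v))"
proof -
  define n where "n = card (pverts G)"
  define vs where "vs = vertex_list G"
  have vs: "distinct vs" "set vs = pverts G" "length vs = n"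
    using vertex_list[OF fin] by (auto simp: vs_def n_def)
  have bij: "bij_betw ((!) vs) {0..<n} (pverts G)"
    using vs by (simp add: bij_betw_nth atLeast0LessThan)
  have row: "(adjacency_matrix G *\<^sub>v x) $ i = (\<Sum>u | (vs ! i, u) \<in> parcs G. f u)"
    if x: "x \<in> carrier_vec n" and i: "i < n" and f: "\<And>j. j < n \<Longrightarrow> f (vs ! j) = x $ j"
    for x f i
  proof -
    have "(adjacency_matrix G *\<^sub>v x) $ i =
        (\<Sum>j = 0..<n. if (vs ! i, vs ! j) \<in> parcs G then f (vs ! j) else 0)"
      using x i f
      by (auto simp: adjacency_matrix_def scalar_prod_def n_def[symmetric] vs_def[symmetric]
          intro!: sum.cong)
    also have "\<dots> = (\<Sum>u \<in> pverts G. if (vs ! i, u) \<in> parcs G then f u else 0)"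
      by (rule sum.reindex_bij_betw[OF bij])
    also have "\<dots> = (\<Sum>u \<in> {u \<in> pverts G. (vs ! i, u) \<in> parcs G}. f u)"
      using fin by (simp add: sum.inter_filter)
    also have "{u \<in> pverts G. (vs ! i, u) \<in> parcs G} = {u. (vs ! i, u) \<in> parcs G}"
      using wf by auto
    finally show ?thesis .
  qed
  have dim: "dim_row (adjacency_matrix G) = n"
    by (simp add: adjacency_matrix_def n_def)
  show ?thesis
  proof
    assume "eigenvalue (adjacency_matrix G) l"
    then obtain x where x: "x \<in> carrier_vec n" "x \<noteq> 0\<^sub>v n"
        "adjacency_matrix G *\<^sub>v x = l \<cdot>\<^sub>v x"
      unfolding eigenvalue_def eigenvector_def dim by blast
    define f where "f v = x $ (the_inv_into {0..<n} ((!) vs) v)" for v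
    have f: "f (vs ! j) = x $ j" if "j < n" for j
      using that bij by (simp add: f_def the_inv_into_f_f bij_betw_def)
    have "\<exists>j < n. x $ j \<noteq> 0" using x(1,2) by (auto simp: vec_eq_iff)
    then have "\<exists>v \<in> pverts G. f v \<noteq> 0" using f vs by (metis nth_mem)
    moreover have "(\<Sum>u | (v, u) \<in> parcs G. f u) = l * f v" if v: "v \<in> pverts G" for v
    proof -
      obtain i where i: "i < n" "v = vs ! i" using v vs by (metis in_set_conv_nth)
      show ?thesis using row[OF x(1) i(1), of f] f i x by auto
    qed
    ultimately show "\<exists>f. (\<exists>v \<in> pverts G. f v \<noteq> 0) \<and>
        (\<forall>v \<in> pverts G. (\<Sum>u | (v, u) \<in> parcs G. f u) = l * f v)" by blast
  next
    assume "\<exists>f. (\<exists>v \<in> pverts G. f v \<noteq> 0) \<and>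
        (\<forall>v \<in> pverts G. (\<Sum>u | (v, u) \<in> parcs G. f u) = l * f v)"
    then obtain f where f: "\<exists>v \<in> pverts G. f v \<noteq> 0"
      "\<And>v. v \<in> pverts G \<Longrightarrow> (\<Sum>u | (v, u) \<in> parcs G. f u) = l * f v" by blast
    define x where "x = vec n (\<lambda>i. f (vs ! i))"
    have x: "x \<in> carrier_vec n" by (simp add: x_def)
    obtain i where i: "i < n" "f (vs ! i) \<noteq> 0" using f(1) vs by (metis in_set_conv_nth)
    have "x \<noteq> 0\<^sub>v n"
    proof
      assume "x = 0\<^sub>v n"
      then have "x $ i = 0" using i by simp
      then show False using i by (simp add: x_def)
    qed
    moreover have "adjacency_matrix G *\<^sub>v x = l \<cdot>\<^sub>v x"
    proof (rule eq_vecI)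
      fix i assume "i < dim_vec (l \<cdot>\<^sub>v x)"
      then have i: "i < n" by (simp add: x_def)
      then have "vs ! i \<in> pverts G" using vs by (metis nth_mem)
      then show "(adjacency_matrix G *\<^sub>v x) $ i = (l \<cdot>\<^sub>v x) $ i"
        using row[OF x i, of f] f(2) i by (simp add: x_def)
    qed (simp add: dim x_def)
    ultimately show "eigenvalue (adjacency_matrix G) l"
      using x unfolding eigenvalue_def eigenvector_def dim by blast
  qed
qed

end

theory Submission
  imports Defs
begin

text \<open>
  A connected graph has a positive eigenvector for its spectral radius \<open>\<rho>\<close>. Pairing with it shows
  that a nonnegative nonzero \<open>f\<close> with \<open>A f \<ge> t f\<close> forces \<open>\<rho> \<ge> t\<close> (strictly if \<open>f\<close> vanishes
  somewhere or the inequality is strict somewhere), and a positive \<open>f\<close> with \<open>A f \<le> t f\<close> forces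
  \<open>\<rho> \<le> t\<close>; in particular \<open>\<rho>\<close> increases strictly when edges are added to a connected spanning
  subgraph. It is therefore enough to find the extremal graph as a spanning subgraph of a minimiser.

  For \<open>\<gamma> = 1\<close> the spanning star is given by a dominating vertex.

  For \<open>\<gamma> = \<lceil>n/3\<rceil>\<close> the path \<open>P\<^sub>n\<close> has the right domination number and \<open>\<rho> \<le> 2 cos (\<pi> / (n + 1))\<close>. A
  connected graph with all degrees at most 2 has a spanning path. At a vertex of degree at least 3
  choose three disjoint paths of maximal total length. If they span, a vector made of sine waves on
  the three legs gives \<open>\<rho> > 2 cos (\<pi> / (n + 1))\<close>; otherwise the graph contains an affine Dynkin
  diagram of type \<open>D\<close>, and \<open>\<rho> \<ge> 2\<close>.

  For \<open>\<gamma> = 2\<close> and \<open>n \<ge> 7\<close> put \<open>k = \<lceil>n/2\<rceil>\<close>. The balanced \<open>H\<close> has \<open>\<rho> \<le> \<surd>k\<close>, strictly if \<open>n\<close> is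
  odd. A vertex of degree at least \<open>k\<close> would give \<open>\<rho> > \<surd>k\<close>, so the closed neighbourhoods of a
  dominating pair have at most \<open>k\<close> elements. Either they partition the vertices, and an edge between
  them completes a spanning balanced \<open>H\<close>; or they meet in one vertex, \<open>n\<close> is odd, and \<open>\<rho> \<ge> \<surd>k\<close>.
  For \<open>n \<le> 6\<close> the graph \<open>H\<close> is a path.
\<close>

section \<open>Perron vectors and the spectral radius\<close>

lemma convergent_subseq_real:
  fixes x :: "nat \<Rightarrow> real"
  assumes "\<And>i. \<bar>x i\<bar> \<le> 1"
  shows "\<exists>r. strict_mono r \<and> convergent (x \<circ> r)"
proof -
  obtain r where r: "strict_mono (r :: nat \<Rightarrow> nat)" "monoseq (\<lambda>i. x (r i))"
    using seq_monosub[of x] by blast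
  have "Bseq (\<lambda>i. x (r i))"
    by (rule BseqI'[where K = 1]) (use assms in auto)
  then show ?thesis using r Bseq_monoseq_convergent by (auto simp: comp_def)
qed

text \<open>Since \<open>V\<close> is finite, subsequences can be extracted one coordinate at a
  time; no diagonal argument is needed. This supplies the limit at which the quadratic form is
  maximal.\<close>

lemma pointwise_convergent_subseq:
  fixes x :: "nat \<Rightarrow> 'a \<Rightarrow> real"
  assumes "finite V" and "\<And>i v. v \<in> V \<Longrightarrow> \<bar>x i v\<bar> \<le> 1"
  shows "\<exists>r. strict_mono r \<and> (\<forall>v \<in> V. convergent (\<lambda>i. x (r i) v))"
  using assms
proof (induction V rule: finite_induct)
  case empty
  then show ?case by (auto intro: strict_mono_id)
next
  case (insert w V)
  then obtain r where r: "strict_mono r" "\<And>v. v \<in> V \<Longrightarrow> convergent (\<lambda>i. x (r i) v)" by auto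
  obtain r' where r': "strict_mono r'" "convergent ((\<lambda>i. x (r i) w) \<circ> r')"
    using convergent_subseq_real[of "\<lambda>i. x (r i) w"] insert.prems by auto
  have "convergent (\<lambda>i. x ((r \<circ> r') i) v)" if "v \<in> V" for v
    using convergent_subseq_convergent[OF r(2)[OF that] r'(1)] by (simp add: comp_def)
  then show ?case
    using r r' by (intro exI[of _ "r \<circ> r'"]) (auto simp: strict_mono_def comp_def)
qed

section \<open>Neighbourhoods and the adjacency operator\<close>

definition nbrs :: "'a pair_pre_digraph \<Rightarrow> 'a \<Rightarrow> 'a set" where
  "nbrs G v = {u. (v, u) \<in> parcs G}"

locale connected_graph = pair_graph +
  assumes connected: "Digraph_Component.connected (with_proj G)"
begin

lemma nonempty: "pverts G \<noteq> {}"
  using connected by (simp add: connected_conv)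

lemma nbrs_subset: "nbrs G v \<subseteq> pverts G"
  by (auto simp: nbrs_def dest: in_arcsD2)

lemma finite_nbrs [simp]: "finite (nbrs G v)"
  using nbrs_subset pair_finite_verts by (rule finite_subset)

lemma nbrs_sym: "u \<in> nbrs G v \<longleftrightarrow> v \<in> nbrs G u"
  by (auto simp: nbrs_def intro: arcs_symmetric)

lemma nbrs_irrefl [simp]: "v \<notin> nbrs G v"
  by (auto simp: nbrs_def dest: no_loops')

text \<open>This is the form in which connectedness is used below. A set that no arc leaves is
  closed under reachability, so by strong connectedness it would contain every vertex.\<close>

lemma cut_arc:
  assumes "S \<noteq> {}" "S \<subset> pverts G"
  obtains u v where "u \<in> S" "v \<in> pverts G - S" "v \<in> nbrs G u"
proof (rule ccontr)
  assume "\<not> thesis"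
  then have *: "\<not> (u \<in> S \<and> v \<in> pverts G - S \<and> v \<in> nbrs G u)" for u v using that by blast
  have closed: "v \<in> S" if "u \<in> S" "(u, v) \<in> parcs G" for u v
    using *[of u v] that by (auto simp: nbrs_def dest: in_arcsD2)
  obtain a b where ab: "a \<in> S" "b \<in> pverts G" "b \<notin> S" using assms by blast
  have "strongly_connected (with_proj G)"
    using symmetric_connected_imp_strongly_connected pair_sym_arcs connected by blast
  then have "a \<rightarrow>\<^sup>*\<^bsub>with_proj G\<^esub> b" using ab assms by (auto simp: strongly_connected_def)
  then have "b \<in> S"
    using ab(1) by (induction rule: reachable_induct) (auto intro: closed)
  then show False using ab by simp
qed

text \<open>Self-adjointness of the adjacency operator, which rests on the symmetry of the
  arcs.\<close>

lemma nbr_sum_swap: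
  fixes f g :: "'a \<Rightarrow> real"
  shows "(\<Sum>v \<in> pverts G. f v * (\<Sum>u \<in> nbrs G v. g u))
       = (\<Sum>v \<in> pverts G. g v * (\<Sum>u \<in> nbrs G v. f u))"
proof -
  have *: "f v * (\<Sum>u \<in> nbrs G v. g u)
      = (\<Sum>u \<in> pverts G. if u \<in> nbrs G v then f v * g u else 0)"
    for v and f g :: "'a \<Rightarrow> real"
    using nbrs_subset[of v] pair_finite_verts
    by (simp add: sum_distrib_left sum.If_cases Int_absorb1)
  show ?thesis
    unfolding * by (subst sum.swap) (intro sum.cong, auto simp: nbrs_sym mult.commute)
qed

section \<open>The Rayleigh quotient and a positive eigenvector\<close>

definition energy :: "('a \<Rightarrow> real) \<Rightarrow> real" where
  "energy f = (\<Sum>v \<in> pverts G. f v * (\<Sum>u \<in> nbrs G v. f u))"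

definition sq_norm :: "('a \<Rightarrow> real) \<Rightarrow> real" where
  "sq_norm f = (\<Sum>v \<in> pverts G. (f v)\<^sup>2)"

lemma le_one_if_sq_norm_one:
  assumes "sq_norm f = 1" "v \<in> pverts G"
  shows "\<bar>f v\<bar> \<le> 1"
proof -
  have "(f v)\<^sup>2 \<le> sq_norm f"
    unfolding sq_norm_def using assms pair_finite_verts by (intro member_le_sum) auto
  then show ?thesis using assms by (simp add: abs_square_le_1)
qed

text \<open>Replacing \<open>g\<close> by its absolute value keeps the norm and does not lower the
  energy, so it suffices to maximise over nonnegative unit vectors. There a maximising sequence has
  a convergent subsequence, and norm and energy, being finite sums, pass to the limit.\<close>

lemma energy_attains_max:
  "\<exists>f. sq_norm f = 1 \<and> (\<forall>v \<in> pverts G. 0 \<le> f v) \<and> (\<forall>g. sq_norm g = 1 \<longrightarrow> energy g \<le> energy f)"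
proof -
  let ?V = "pverts G"
  define K where "K = {f. sq_norm f = 1 \<and> (\<forall>v \<in> ?V. 0 \<le> f v)}"
  obtain w where w: "w \<in> ?V" using nonempty by blast
  have "(\<lambda>v. if v = w then 1 else 0) \<in> K"
    using w pair_finite_verts by (simp add: K_def sq_norm_def if_distrib[of "\<lambda>x. x\<^sup>2"] cong: if_cong)
  then have ne: "energy ` K \<noteq> {}" by blast
  have bound: "energy f \<le> (\<Sum>v \<in> ?V. \<Sum>u \<in> nbrs G v. 1)" if "f \<in> K" for f
    unfolding energy_def sum_distrib_left
  proof (intro sum_mono)
    fix v u assume vu: "v \<in> ?V" "u \<in> nbrs G v"
    then have "u \<in> ?V" using nbrs_subset by blast
    then have "\<bar>f v\<bar> * \<bar>f u\<bar> \<le> 1 * 1"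
      using that vu by (intro mult_mono le_one_if_sq_norm_one) (auto simp: K_def)
    then show "f v * f u \<le> 1" by (simp flip: abs_mult)
  qed
  then have bdd: "bdd_above (energy ` K)" by (auto simp: bdd_above_def)
  define s where "s = Sup (energy ` K)"
  have "\<exists>f. f \<in> K \<and> s - 1 / real (Suc i) < energy f" for i
    using less_cSup_iff[OF ne bdd, of "s - 1 / real (Suc i)"] by (auto simp: s_def)
  then obtain x where x: "\<And>i. x i \<in> K" "\<And>i. s - 1 / real (Suc i) < energy (x i)" by metis
  have "\<bar>x i v\<bar> \<le> 1" if "v \<in> ?V" for i v
    using x(1)[of i] by (intro le_one_if_sq_norm_one that) (simp add: K_def)
  then obtain r where r: "strict_mono r" "\<And>v. v \<in> ?V \<Longrightarrow> convergent (\<lambda>i. x (r i) v)"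
    using pointwise_convergent_subseq[OF pair_finite_verts, of x] by auto
  define f where "f v = lim (\<lambda>i. x (r i) v)" for v
  have lim: "(\<lambda>i. x (r i) v) \<longlonglongrightarrow> f v" if "v \<in> ?V" for v
    using r(2)[OF that] by (simp add: f_def convergent_LIMSEQ_iff)
  have "(\<lambda>i. sq_norm (x (r i))) \<longlonglongrightarrow> sq_norm f"
    unfolding sq_norm_def by (intro tendsto_sum tendsto_power lim)
  then have sq: "sq_norm f = 1"
    using x(1) by (simp add: K_def LIMSEQ_const_iff)
  have nonneg: "0 \<le> f v" if "v \<in> ?V" for v
    using lim[OF that] x(1) that by (intro LIMSEQ_le_const) (auto simp: K_def)
  have "(\<lambda>i. energy (x (r i))) \<longlonglongrightarrow> energy f"
    unfolding energy_def using nbrs_subset by (intro tendsto_sum tendsto_mult lim) auto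
  moreover have "(\<lambda>i. s - 1 / real (Suc i)) \<longlonglongrightarrow> s - 0"
    by (intro tendsto_diff tendsto_const lim_1_over_n[THEN LIMSEQ_Suc])
  then have "((\<lambda>i. s - 1 / real (Suc i)) \<circ> r) \<longlonglongrightarrow> s"
    using LIMSEQ_subseq_LIMSEQ r(1) by auto
  ultimately have s_le: "s \<le> energy f"
    using x(2) by (intro LIMSEQ_le) (auto simp: comp_def intro: less_imp_le)
  have "energy g \<le> energy f" if "sq_norm g = 1" for g
  proof -
    have "energy g \<le> energy (\<lambda>v. \<bar>g v\<bar>)"
      unfolding energy_def sum_distrib_left
      by (intro sum_mono) (simp flip: abs_mult)
    also have "\<dots> \<le> s"
      unfolding s_def by (intro cSup_upper bdd imageI) (use that in \<open>auto simp: K_def sq_norm_def\<close>)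
    finally show ?thesis using s_le by simp
  qed
  then show ?thesis using sq nonneg by blast
qed

text \<open>The energy is affine in \<open>s\<close>: the term of order two would need a loop at
  \<open>v\<close>.\<close>

lemma energy_perturb:
  assumes "v \<in> pverts G"
  shows "energy (\<lambda>u. f u + (if u = v then s else 0)) = energy f + 2 * s * (\<Sum>u \<in> nbrs G v. f u)"
proof -
  define e where "e u = (if u = v then s else (0 :: real))" for u
  have e1: "(\<Sum>u \<in> pverts G. e u * (\<Sum>w \<in> nbrs G u. h w)) = s * (\<Sum>w \<in> nbrs G v. h w)" for h
    using assms pair_finite_verts by (simp add: e_def if_distrib[of "\<lambda>x. x * _"] cong: if_cong)
  have "energy (\<lambda>u. f u + e u) = energy f + (\<Sum>u \<in> pverts G. f u * (\<Sum>w \<in> nbrs G u. e w))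
     + (\<Sum>u \<in> pverts G. e u * (\<Sum>w \<in> nbrs G u. f w)) + (\<Sum>u \<in> pverts G. e u * (\<Sum>w \<in> nbrs G u. e w))"
    unfolding energy_def by (simp add: sum.distrib algebra_simps)
  also have "(\<Sum>u \<in> pverts G. f u * (\<Sum>w \<in> nbrs G u. e w)) = s * (\<Sum>w \<in> nbrs G v. f w)"
    by (subst nbr_sum_swap) (rule e1)
  also have "(\<Sum>u \<in> pverts G. e u * (\<Sum>w \<in> nbrs G u. e w)) = 0"
    unfolding e1 by (auto simp: e_def intro!: sum.neutral)
  finally show ?thesis unfolding e1 by (simp add: e_def)
qed

lemma sq_norm_perturb:
  assumes "v \<in> pverts G"
  shows "sq_norm (\<lambda>u. f u + (if u = v then s else 0)) = sq_norm f + 2 * s * f v + s\<^sup>2"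
proof -
  have "sq_norm (\<lambda>u. f u + (if u = v then s else 0)) =
      (\<Sum>u \<in> pverts G. (f u)\<^sup>2 + (if u = v then 2 * s * f v + s\<^sup>2 else 0))"
    unfolding sq_norm_def by (intro sum.cong) (auto simp: power2_eq_square algebra_simps)
  then show ?thesis
    using assms pair_finite_verts by (simp add: sum.distrib sq_norm_def)
qed

text \<open>A maximiser of the Rayleigh quotient is stationary in every coordinate direction.\<close>

lemma eigenvector_nonneg:
  "\<exists>f r. (\<forall>v \<in> pverts G. 0 \<le> f v) \<and> (\<exists>v \<in> pverts G. f v \<noteq> 0) \<and>
     (\<forall>v \<in> pverts G. (\<Sum>u \<in> nbrs G v. f u) = (r :: real) * f v)"
proof -
  obtain f where f: "sq_norm f = 1" "\<And>v. v \<in> pverts G \<Longrightarrow> 0 \<le> f v"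
    "\<And>g. sq_norm g = 1 \<Longrightarrow> energy g \<le> energy f"
    using energy_attains_max by blast
  define r where "r = energy f"
  \<comment> \<open>Both sides are homogeneous of degree two, so the maximum over unit vectors
    bounds the form everywhere.\<close>
  have le: "energy g \<le> r * sq_norm g" for g
  proof (cases "sq_norm g = 0")
    case True
    then have "g v = 0" if "v \<in> pverts G" for v
      using that pair_finite_verts by (auto simp: sq_norm_def sum_nonneg_eq_0_iff)
    then have "energy g = 0" by (simp add: energy_def)
    then show ?thesis using True by simp
  next
    case False
    then have pos: "0 < sq_norm g" by (simp add: sq_norm_def sum_nonneg order_less_le)
    define c where "c = 1 / sqrt (sq_norm g)"
    have c2: "c\<^sup>2 = 1 / sq_norm g" using pos by (simp add: c_def power_divide)
    have "sq_norm (\<lambda>v. c * g v) = c\<^sup>2 * sq_norm g"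
      by (simp add: sq_norm_def power_mult_distrib sum_distrib_left)
    then have "energy (\<lambda>v. c * g v) \<le> r" using c2 pos f(3) by (simp add: r_def)
    moreover have "energy (\<lambda>v. c * g v) = c\<^sup>2 * energy g"
      by (simp add: energy_def power2_eq_square sum_distrib_left algebra_simps)
    ultimately show ?thesis using c2 pos by (simp add: field_simps)
  qed
  have "(\<Sum>u \<in> nbrs G v. f u) = r * f v" if v: "v \<in> pverts G" for v
  proof -
    define d where "d = (\<Sum>u \<in> nbrs G v. f u) - r * f v"
    have *: "2 * s * d \<le> r * s\<^sup>2" for s
      using le[of "\<lambda>u. f u + (if u = v then s else 0)"]
      unfolding energy_perturb[OF v] sq_norm_perturb[OF v] f(1) r_def[symmetric]
      by (simp add: d_def algebra_simps)
    have R: "\<bar>r\<bar> + 1 > 0" by simp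
    \<comment> \<open>A step proportional to the defect \<open>d\<close>, so short that the linear
      gain exceeds the quadratic loss unless \<open>d\<close> is zero. The added 1 keeps the
      denominator positive when \<open>r\<close> vanishes.\<close>
    define s where "s = d / (\<bar>r\<bar> + 1)"
    have d: "d = s * (\<bar>r\<bar> + 1)" using R by (simp add: s_def)
    have "2 * (\<bar>r\<bar> + 1) * s\<^sup>2 \<le> r * s\<^sup>2"
      using *[of s] unfolding d by (simp add: power2_eq_square mult_ac)
    also have "\<dots> \<le> (\<bar>r\<bar> + 1) * s\<^sup>2" by (intro mult_right_mono) auto
    finally have "(\<bar>r\<bar> + 1) * s\<^sup>2 \<le> 0" by linarith
    then have "s = 0" using R by (simp add: mult_le_0_iff)
    then show ?thesis using d by (simp add: d_def)
  qed
  moreover have "\<exists>v \<in> pverts G. f v \<noteq> 0"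
  proof (rule ccontr)
    assume "\<not> ?thesis"
    then have "sq_norm f = 0" by (simp add: sq_norm_def)
    then show False using f(1) by simp
  qed
  ultimately show ?thesis using f(2) by blast
qed

text \<open>A nonnegative eigenvector that vanishes at \<open>u\<close> has neighbour sum zero
  there, so it vanishes at all neighbours of \<open>u\<close>. Hence no arc leaves the zero set,
  which must then be empty.\<close>

lemma eigenvector_pos:
  "\<exists>f r. (\<forall>v \<in> pverts G. 0 < f v) \<and> (\<forall>v \<in> pverts G. (\<Sum>u \<in> nbrs G v. f u) = (r :: real) * f v)"
proof -
  obtain f and r :: real where f: "\<And>v. v \<in> pverts G \<Longrightarrow> 0 \<le> f v" "\<exists>v \<in> pverts G. f v \<noteq> 0"
    "\<And>v. v \<in> pverts G \<Longrightarrow> (\<Sum>u \<in> nbrs G v. f u) = r * f v"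
    using eigenvector_nonneg by blast
  define S where "S = {v \<in> pverts G. f v = 0}"
  have "S = {}"
  proof (rule ccontr)
    assume "S \<noteq> {}"
    moreover have "S \<subset> pverts G" using f(2) by (auto simp: S_def)
    ultimately obtain u v where uv: "u \<in> S" "v \<in> pverts G - S" "v \<in> nbrs G u"
      by (rule cut_arc)
    have "(\<Sum>w \<in> nbrs G u. f w) = 0" using f(3)[of u] uv by (simp add: S_def)
    then have "f v = 0"
      using uv nbrs_subset f(1) by (subst (asm) sum_nonneg_eq_0_iff) auto
    then show False using uv by (simp add: S_def)
  qed
  then have "0 < f v" if "v \<in> pverts G" for v
    using that f(1)[of v] by (auto simp: S_def order_less_le)
  then show ?thesis using f(3) by blast
qed

section \<open>Bounds by sub- and supersolutions\<close>

lemma eigenvalue_iff: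
  "eigenvalue (adjacency_matrix G) l \<longleftrightarrow>
    (\<exists>f. (\<exists>v \<in> pverts G. f v \<noteq> 0) \<and> (\<forall>v \<in> pverts G. (\<Sum>u \<in> nbrs G v. f u) = l * f v))"
  unfolding nbrs_def
  by (rule eigenvalue_adjacency_matrix_iff) (auto simp: pair_finite_verts dest: in_arcsD1 in_arcsD2)

lemma finite_eigenvalues: "finite {l. eigenvalue (adjacency_matrix G) l}"
  using card_finite_spectrum(1)[of "adjacency_matrix G" "card (pverts G)"]
  by (simp add: spectrum_def adjacency_matrix_def)

text \<open>At a vertex maximising \<open>\<bar>g\<bar> / f\<close> an eigenvector \<open>g\<close> cannot grow faster than \<open>f\<close>; in the
  case of equality the maximum spreads to the neighbours.\<close>

lemma eigenvalue_le_supersolution: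
  assumes ev: "eigenvalue (adjacency_matrix G) l"
    and pos: "\<And>v. v \<in> pverts G \<Longrightarrow> 0 < f v"
    and sup: "\<And>v. v \<in> pverts G \<Longrightarrow> (\<Sum>u \<in> nbrs G v. f u) \<le> t * f v"
  shows "l \<le> t"
    and "w \<in> pverts G \<Longrightarrow> (\<Sum>u \<in> nbrs G w. f u) < t * f w \<Longrightarrow> l < t"
proof -
  obtain g z where g: "z \<in> pverts G" "g z \<noteq> 0"
    "\<And>v. v \<in> pverts G \<Longrightarrow> (\<Sum>u \<in> nbrs G v. g u) = l * g v"
    using ev unfolding eigenvalue_iff by blast
  define M where "M = Max ((\<lambda>v. \<bar>g v\<bar> / f v) ` pverts G)"
  have M: "\<bar>g v\<bar> \<le> M * f v" if "v \<in> pverts G" for v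
  proof -
    have "\<bar>g v\<bar> / f v \<le> M"
      unfolding M_def using that pair_finite_verts by (intro Max_ge) auto
    then show ?thesis using pos[OF that] by (simp add: field_simps)
  qed
  have "M \<in> (\<lambda>v. \<bar>g v\<bar> / f v) ` pverts G"
    unfolding M_def using pair_finite_verts nonempty by (intro Max_in) auto
  then obtain m where m: "m \<in> pverts G" "M = \<bar>g m\<bar> / f m" by blast
  then have gm: "\<bar>g m\<bar> = M * f m" using pos[of m] by simp
  have Mpos: "M > 0"
    using M[OF g(1)] g(2) pos[OF g(1)] by (smt (verit) mult_nonpos_nonneg)
  define S where "S = {v \<in> pverts G. \<bar>g v\<bar> = M * f v}"
  have chain: "l * \<bar>g v\<bar> \<le> (\<Sum>u \<in> nbrs G v. \<bar>g u\<bar>)" "(\<Sum>u \<in> nbrs G v. \<bar>g u\<bar>) \<le> M * (\<Sum>u \<in> nbrs G v. f u)"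
    "M * (\<Sum>u \<in> nbrs G v. f u) \<le> t * \<bar>g v\<bar>"
    if "v \<in> S" for v
  proof -
    have v: "v \<in> pverts G" "\<bar>g v\<bar> = M * f v" using that by (auto simp: S_def)
    have "l * \<bar>g v\<bar> \<le> \<bar>l * g v\<bar>" by (simp add: abs_mult mult_right_mono)
    also have "\<dots> \<le> (\<Sum>u \<in> nbrs G v. \<bar>g u\<bar>)" unfolding g(3)[OF v(1), symmetric] by (rule sum_abs)
    finally show "l * \<bar>g v\<bar> \<le> (\<Sum>u \<in> nbrs G v. \<bar>g u\<bar>)" .
    show "(\<Sum>u \<in> nbrs G v. \<bar>g u\<bar>) \<le> M * (\<Sum>u \<in> nbrs G v. f u)"
      unfolding sum_distrib_left using M nbrs_subset by (intro sum_mono) auto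
    show "M * (\<Sum>u \<in> nbrs G v. f u) \<le> t * \<bar>g v\<bar>"
      using mult_left_mono[OF sup[OF v(1)], of M] Mpos v(2) by (simp add: mult_ac)
  qed
  have mS: "m \<in> S" using m gm by (simp add: S_def)
  have pos_S: "0 < \<bar>g v\<bar>" if "v \<in> S" for v
    using that Mpos pos[of v] by (auto simp: S_def)
  show le: "l \<le> t"
    using chain[OF mS] pos_S[OF mS] by (meson mult_le_cancel_right_pos order_trans)
  show "l < t" if w: "w \<in> pverts G" "(\<Sum>u \<in> nbrs G w. f u) < t * f w"
  proof (rule ccontr)
    assume "\<not> l < t"
    then have lt: "l = t" using le by simp
    \<comment> \<open>If \<open>l = t\<close>, the inequalities of \<open>chain\<close> are
      equalities on \<open>S\<close>. Then every neighbour of a vertex of \<open>S\<close> is again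
      in \<open>S\<close>, so \<open>S\<close> reaches \<open>w\<close>, where the last inequality
      is strict.\<close>
    have "S = pverts G"
    proof (rule ccontr)
      assume "S \<noteq> pverts G"
      then have "S \<noteq> {}" "S \<subset> pverts G" using mS by (auto simp: S_def)
      then obtain u v where uv: "u \<in> S" "v \<in> pverts G - S" "v \<in> nbrs G u"
        by (rule cut_arc)
      have "(\<Sum>x \<in> nbrs G u. \<bar>g x\<bar>) < (\<Sum>x \<in> nbrs G u. M * f x)"
      proof (rule sum_strict_mono_ex1)
        show "\<forall>x \<in> nbrs G u. \<bar>g x\<bar> \<le> M * f x" using M nbrs_subset by blast
        show "\<exists>x \<in> nbrs G u. \<bar>g x\<bar> < M * f x"
          using uv M[of v] by (intro bexI[of _ v]) (auto simp: S_def)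
      qed simp
      then show False using chain[OF uv(1)] lt by (simp add: sum_distrib_left)
    qed
    then have wS: "w \<in> S" using w by simp
    have "M * (\<Sum>u \<in> nbrs G w. f u) < t * \<bar>g w\<bar>"
      using wS w(2) Mpos by (simp add: S_def mult_ac)
    then show False using chain[OF wS] lt by simp
  qed
qed

text \<open>A positive eigenvector is a supersolution for its own eigenvalue, which therefore bounds
  all the others and is the maximum.\<close>

lemma perron_vector:
  "\<exists>f. (\<forall>v \<in> pverts G. 0 < f v) \<and>
     (\<forall>v \<in> pverts G. (\<Sum>u \<in> nbrs G v. f u) = graph_spectral_radius G * f v)"
proof -
  obtain f and r :: real where f: "\<And>v. v \<in> pverts G \<Longrightarrow> 0 < f v"
    "\<And>v. v \<in> pverts G \<Longrightarrow> (\<Sum>u \<in> nbrs G v. f u) = r * f v"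
    using eigenvector_pos by blast
  have "\<exists>v \<in> pverts G. f v \<noteq> 0" using f(1) nonempty by fastforce
  then have "eigenvalue (adjacency_matrix G) r" unfolding eigenvalue_iff using f(2) by blast
  moreover have "l \<le> r" if "eigenvalue (adjacency_matrix G) l" for l
    using eigenvalue_le_supersolution(1)[OF that, of f r] f by simp
  ultimately have "graph_spectral_radius G = r"
    unfolding graph_spectral_radius_def by (intro Max_eqI finite_eigenvalues) auto
  then show ?thesis using f by blast
qed

lemma eigenvalue_spectral_radius: "eigenvalue (adjacency_matrix G) (graph_spectral_radius G)"
proof -
  obtain f where f: "\<And>v. v \<in> pverts G \<Longrightarrow> 0 < f v"
    "\<And>v. v \<in> pverts G \<Longrightarrow> (\<Sum>u \<in> nbrs G v. f u) = graph_spectral_radius G * f v"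
    using perron_vector by blast
  have "\<exists>v \<in> pverts G. f v \<noteq> 0" using f(1) nonempty by fastforce
  then show ?thesis unfolding eigenvalue_iff using f(2) by blast
qed

lemmas spectral_radius_le = eigenvalue_le_supersolution(1)[OF eigenvalue_spectral_radius]
lemmas spectral_radius_less = eigenvalue_le_supersolution(2)[OF eigenvalue_spectral_radius]

text \<open>Let \<open>h\<close> be the Perron vector. By self-adjointness the spectral radius times
  the inner product of \<open>h\<close> and \<open>f\<close> equals the inner product of
  \<open>h\<close> with the neighbour sums of \<open>f\<close>, which is at least \<open>t\<close>
  times the former product. Positivity of \<open>h\<close> carries strictness at one vertex over to
  the sum.\<close>

lemma spectral_radius_ge:
  assumes nonneg: "\<And>v. v \<in> pverts G \<Longrightarrow> 0 \<le> f v"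
    and nz: "z \<in> pverts G" "f z \<noteq> 0"
    and sub: "\<And>v. v \<in> pverts G \<Longrightarrow> t * f v \<le> (\<Sum>u \<in> nbrs G v. f u)"
  shows "t \<le> graph_spectral_radius G"
    and "w \<in> pverts G \<Longrightarrow> t * f w < (\<Sum>u \<in> nbrs G w. f u) \<Longrightarrow> t < graph_spectral_radius G"
proof -
  let ?r = "graph_spectral_radius G"
  obtain h where h: "\<And>v. v \<in> pverts G \<Longrightarrow> 0 < h v"
    "\<And>v. v \<in> pverts G \<Longrightarrow> (\<Sum>u \<in> nbrs G v. h u) = ?r * h v"
    using perron_vector by blast
  define p where "p = (\<Sum>v \<in> pverts G. h v * f v)"
  have ppos: "0 < p"
    unfolding p_def
  proof (rule sum_pos2)
    show "0 < h z * f z" using h(1) nz nonneg[of z] by (simp add: order_less_le)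
    show "0 \<le> h v * f v" if "v \<in> pverts G" for v using that h(1) nonneg by (simp add: less_imp_le)
  qed (use nz pair_finite_verts in auto)
  have "?r * p = (\<Sum>v \<in> pverts G. f v * (\<Sum>u \<in> nbrs G v. h u))"
    unfolding p_def sum_distrib_left[of _ _ "pverts G"] by (intro sum.cong) (simp_all add: h(2))
  also have "\<dots> = (\<Sum>v \<in> pverts G. h v * (\<Sum>u \<in> nbrs G v. f u))" by (rule nbr_sum_swap)
  finally have rp: "?r * p = (\<Sum>v \<in> pverts G. h v * (\<Sum>u \<in> nbrs G v. f u))" .
  have tp: "t * p = (\<Sum>v \<in> pverts G. h v * (t * f v))"
    unfolding p_def sum_distrib_left by (intro sum.cong) (auto simp: mult_ac)
  have le: "h v * (t * f v) \<le> h v * (\<Sum>u \<in> nbrs G v. f u)" if "v \<in> pverts G" for v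
    using h(1)[OF that] sub[OF that] by (simp add: less_imp_le mult_left_mono)
  have "t * p \<le> ?r * p" unfolding rp tp using le by (rule sum_mono)
  then show "t \<le> ?r" using ppos by simp
  show "t < ?r" if w: "w \<in> pverts G" "t * f w < (\<Sum>u \<in> nbrs G w. f u)"
  proof -
    have "h w * (t * f w) < h w * (\<Sum>u \<in> nbrs G w. f u)" using h(1) w by simp
    then have "t * p < ?r * p"
      unfolding rp tp using le w(1) pair_finite_verts by (intro sum_strict_mono_ex1) auto
    then show ?thesis using ppos by simp
  qed
qed

text \<open>An arc from the zero set of \<open>f\<close> to its support starts at a vertex where the
  left side is zero and the neighbour sum is positive.\<close>

lemma spectral_radius_greater_if_zero:
  assumes nonneg: "\<And>v. v \<in> pverts G \<Longrightarrow> 0 \<le> f v"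
    and nz: "z \<in> pverts G" "f z \<noteq> 0"
    and sub: "\<And>v. v \<in> pverts G \<Longrightarrow> t * f v \<le> (\<Sum>u \<in> nbrs G v. f u)"
    and zero: "y \<in> pverts G" "f y = 0"
  shows "t < graph_spectral_radius G"
proof -
  obtain u v where uv: "u \<in> {v \<in> pverts G. f v = 0}" "v \<in> pverts G - {v \<in> pverts G. f v = 0}"
      "v \<in> nbrs G u"
    by (rule cut_arc[of "{v \<in> pverts G. f v = 0}"]) (use nz zero in auto)
  have "0 < (\<Sum>w \<in> nbrs G u. f w)"
    using uv nonneg nbrs_subset by (intro sum_pos2[of _ v]) (auto simp: order_less_le)
  then have "t * f u < (\<Sum>w \<in> nbrs G u. f w)" using uv by simp
  then show ?thesis using spectral_radius_ge(2)[of f z t u] nonneg nz sub uv by blast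
qed

end

text \<open>The Perron vector of \<open>H\<close> is a subsolution in \<open>G\<close>, and a strict
  one at the tail of an arc that \<open>H\<close> lacks.\<close>

lemma spectral_radius_subgraph_less:
  assumes "connected_graph G" "connected_graph H" "pverts H = pverts G" "parcs H \<subset> parcs G"
  shows "graph_spectral_radius H < graph_spectral_radius G"
proof -
  interpret G: connected_graph G by fact
  interpret H: connected_graph H by fact
  obtain h where h: "\<And>v. v \<in> pverts H \<Longrightarrow> 0 < h v"
    "\<And>v. v \<in> pverts H \<Longrightarrow> (\<Sum>u \<in> nbrs H v. h u) = graph_spectral_radius H * h v"
    using H.perron_vector by blast
  have sub: "nbrs H v \<subseteq> nbrs G v" for v using assms(4) by (auto simp: nbrs_def)
  have pos: "0 < h v" if "v \<in> nbrs G u" for u v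
    using that h(1) assms(3) G.nbrs_subset by blast
  obtain a b where ab: "(a, b) \<in> parcs G" "(a, b) \<notin> parcs H" using assms(4) by auto
  then have a: "a \<in> pverts G" by (auto dest: G.in_arcsD1)
  show ?thesis
  proof (rule G.spectral_radius_ge(2)[where f = h and z = a and w = a])
    show "graph_spectral_radius H * h v \<le> (\<Sum>u \<in> nbrs G v. h u)" if "v \<in> pverts G" for v
      unfolding h(2)[of v, unfolded assms(3), OF that, symmetric]
      by (intro sum_mono2 sub) (auto intro: less_imp_le pos)
    show "graph_spectral_radius H * h a < (\<Sum>u \<in> nbrs G a. h u)"
      unfolding h(2)[of a, unfolded assms(3), OF a, symmetric]
    proof (rule sum_strict_mono2)
      show b: "b \<in> nbrs G a - nbrs H a" using ab by (simp add: nbrs_def)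
      then show "0 < h b" by (auto intro: pos)
    qed (use sub in \<open>auto intro: less_imp_le pos\<close>)
    show "h a \<noteq> 0" using h(1)[of a] a assms(3) by simp
  qed (use h(1) a assms(3) in \<open>auto intro: less_imp_le\<close>)
qed

lemma (in connected_graph) spectral_radius_eqI:
  assumes "\<And>v. v \<in> pverts G \<Longrightarrow> 0 < f v"
    and "\<And>v. v \<in> pverts G \<Longrightarrow> (\<Sum>u \<in> nbrs G v. f u) = t * f v"
  shows "graph_spectral_radius G = t"
proof (rule antisym)
  show "graph_spectral_radius G \<le> t" using spectral_radius_le[of f t] assms by simp
  obtain z where z: "z \<in> pverts G" using nonempty by blast
  then have "f z \<noteq> 0" using assms(1)[of z] by simp
  then show "t \<le> graph_spectral_radius G"
    using spectral_radius_ge(1)[of f z t] assms z by (simp add: less_imp_le)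
qed

section \<open>Domination numbers and isomorphic copies\<close>

lemma finite_dominating_sets: "finite (pverts G) \<Longrightarrow> finite {D. dominating_set G D}"
  by (rule finite_subset[of _ "Pow (pverts G)"]) (auto simp: dominating_set_def)

lemma domination_number_eqI:
  assumes "finite (pverts G)" "dominating_set G D" "card D \<le> d"
    and "\<And>D'. dominating_set G D' \<Longrightarrow> d \<le> card D'"
  shows "domination_number G = d"
  unfolding domination_number_def
proof (rule Min_eqI)
  have "card D = d" using assms by (meson le_antisym)
  then show "d \<in> card ` {D. dominating_set G D}" using assms(2) by auto
qed (use assms finite_dominating_sets in auto)

lemma domination_number_attained:
  assumes "finite (pverts G)"
  obtains D where "dominating_set G D" "card D = domination_number G"
proof -
  have "dominating_set G (pverts G)" by (simp add: dominating_set_def)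
  then have "card ` {D. dominating_set G D} \<noteq> {}" by blast
  then have "domination_number G \<in> card ` {D. dominating_set G D}"
    unfolding domination_number_def using finite_dominating_sets[OF assms] by (intro Min_in) auto
  then show thesis using that by auto
qed

lemma domination_number_le:
  assumes "finite (pverts G)" "dominating_set G D"
  shows "domination_number G \<le> card D"
  unfolding domination_number_def using assms finite_dominating_sets by (intro Min_le) auto

text \<open>The model graphs are numbered so that descending to a smaller neighbour always ends at
  0.\<close>

lemma connected_if_smaller_nbr:
  assumes "pair_graph K" "pverts K = {..<n}" "0 < n"
    and "\<And>v. 0 < v \<Longrightarrow> v < n \<Longrightarrow> \<exists>u < v. (u, v) \<in> parcs K"
  shows "connected_graph (K :: nat pair_pre_digraph)"
proof -
  interpret K: pair_graph K by fact
  have reach: "0 \<rightarrow>\<^sup>*\<^bsub>with_proj K\<^esub> v \<and> v \<rightarrow>\<^sup>*\<^bsub>with_proj K\<^esub> 0" if "v < n" for v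
    using that
  proof (induction v rule: less_induct)
    case (less v)
    show ?case
    proof (cases "v = 0")
      case True
      then show ?thesis using assms(2,3) by simp
    next
      case False
      then obtain u where u: "u < v" "(u, v) \<in> parcs K" using assms(4) less.prems by blast
      then have "u \<rightarrow>\<^sup>*\<^bsub>with_proj K\<^esub> v" "v \<rightarrow>\<^sup>*\<^bsub>with_proj K\<^esub> u"
        by (auto intro: K.arcs_symmetric)
      then show ?thesis using less u K.reachable_trans by (meson order.strict_trans)
    qed
  qed
  have "strongly_connected (with_proj K)"
    using reach assms(2,3) by (intro strongly_connectedI) (auto intro: K.reachable_trans[of _ 0])
  moreover have "parcs K \<subseteq> (parcs K)\<^sup>s" by (auto simp: symcl_def)
  ultimately have "Digraph_Component.connected (with_proj K)"
    by (auto simp: connected_conv strongly_connected_def reachable_def intro: rtrancl_on_mono)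
  then show ?thesis by unfold_locales
qed

section \<open>Invariance under relabelling of the vertices\<close>

definition map_graph :: "('a \<Rightarrow> 'b) \<Rightarrow> 'a pair_pre_digraph \<Rightarrow> 'b pair_pre_digraph" where
  "map_graph \<phi> K = \<lparr>pverts = \<phi> ` pverts K, parcs = map_prod \<phi> \<phi> ` parcs K\<rparr>"

lemma map_graph_simps [simp]:
  "pverts (map_graph \<phi> K) = \<phi> ` pverts K"
  "parcs (map_graph \<phi> K) = map_prod \<phi> \<phi> ` parcs K"
  by (simp_all add: map_graph_def)

context
  fixes K :: "'a pair_pre_digraph" and \<phi> :: "'a \<Rightarrow> 'b"
  assumes K: "connected_graph K" and inj: "inj_on \<phi> (pverts K)"
begin

interpretation K: connected_graph K by (rule K)

lemma map_graph_arc_iff: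
  assumes uv: "u \<in> pverts K" "v \<in> pverts K"
  shows "(\<phi> u, \<phi> v) \<in> map_prod \<phi> \<phi> ` parcs K \<longleftrightarrow> (u, v) \<in> parcs K"
proof
  assume "(\<phi> u, \<phi> v) \<in> map_prod \<phi> \<phi> ` parcs K"
  then obtain a b where ab: "(a, b) \<in> parcs K" "\<phi> u = \<phi> a" "\<phi> v = \<phi> b" by auto
  then have "u = a" "v = b"
    using inj_onD[OF inj ab(2)] inj_onD[OF inj ab(3)] uv K.in_arcsD1 K.in_arcsD2 by blast+
  then show "(u, v) \<in> parcs K" using ab by simp
qed auto

lemma map_graph_isomorphic: "graph_isomorphic K (map_graph \<phi> K)"
proof -
  define h where "h = \<lparr>iso_verts = \<phi>, iso_arcs = map_prod \<phi> \<phi>, iso_head = snd, iso_tail = fst\<rparr>"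
  have "inj_on (map_prod \<phi> \<phi>) (parcs K)"
    using inj K.in_arcsD1 K.in_arcsD2 by (auto simp: inj_on_def)
  moreover have "wf_digraph (with_proj K)" by (simp add: wf_digraph_wp_iff K.pair_wf_digraph)
  ultimately have "pre_digraph.digraph_isomorphism (with_proj K) h"
    using inj unfolding pre_digraph.digraph_isomorphism_def by (auto simp: h_def)
  moreover have "with_proj (map_graph \<phi> K) = app_iso h (with_proj K)"
    by (simp add: app_iso_def h_def with_proj_def)
  ultimately show ?thesis unfolding graph_isomorphic_def digraph_iso_def by blast
qed

lemma connected_map_graph: "connected_graph (map_graph \<phi> K)"
proof -
  obtain h where h: "pre_digraph.digraph_isomorphism (with_proj K) h"
    "with_proj (map_graph \<phi> K) = app_iso h (with_proj K)"
    using map_graph_isomorphic unfolding graph_isomorphic_def digraph_iso_def by blast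
  have "pair_graph (map_graph \<phi> K)"
  proof unfold_locales
    show "symmetric (with_proj (map_graph \<phi> K))"
      by (force simp: symmetric_def sym_def intro: K.arcs_symmetric)
    show "fst e \<noteq> snd e" if e: "e \<in> parcs (map_graph \<phi> K)" for e
    proof -
      obtain a b where ab: "(a, b) \<in> parcs K" "e = (\<phi> a, \<phi> b)" using e by auto
      then have "a \<in> pverts K" "b \<in> pverts K" "a \<noteq> b"
        using K.in_arcsD1 K.in_arcsD2 K.no_loops' by blast+
      then show ?thesis using ab inj_onD[OF inj, of a b] by auto
    qed
  qed (auto simp: K.pair_finite_verts K.pair_finite_arcs dest: K.in_arcsD1 K.in_arcsD2)
  moreover have "Digraph_Component.connected (with_proj (map_graph \<phi> K))"
    unfolding h(2) using K.connectedI_app_iso[OF K.connected h(1)] .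
  ultimately show ?thesis by (simp add: connected_graph_def connected_graph_axioms_def)
qed

lemma dominating_set_map_graph:
  assumes "D \<subseteq> pverts K"
  shows "dominating_set (map_graph \<phi> K) (\<phi> ` D) \<longleftrightarrow> dominating_set K D"
proof -
  have diff: "\<phi> ` pverts K - \<phi> ` D = \<phi> ` (pverts K - D)"
    using inj assms by (simp add: inj_on_image_set_diff)
  have "(\<exists>u \<in> D. (\<phi> u, \<phi> v) \<in> map_prod \<phi> \<phi> ` parcs K) \<longleftrightarrow> (\<exists>u \<in> D. (u, v) \<in> parcs K)"
    if "v \<in> pverts K - D" for v
    using that assms by (intro bex_cong map_graph_arc_iff) auto
  then have "(\<forall>v \<in> pverts K - D. \<exists>u \<in> D. (\<phi> u, \<phi> v) \<in> map_prod \<phi> \<phi> ` parcs K)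
      \<longleftrightarrow> (\<forall>v \<in> pverts K - D. \<exists>u \<in> D. (u, v) \<in> parcs K)"
    by (rule ball_cong[OF refl])
  then show ?thesis
    unfolding dominating_set_def map_graph_simps diff ball_simps bex_simps using assms by blast
qed

lemma domination_number_map_graph: "domination_number (map_graph \<phi> K) = domination_number K"
proof -
  have card: "card (\<phi> ` D) = card D" if "D \<subseteq> pverts K" for D
    using inj that by (meson card_image inj_on_subset)
  obtain D where D: "dominating_set K D" "card D = domination_number K"
    using domination_number_attained K.pair_finite_verts by blast
  have DV: "D \<subseteq> pverts K" using D(1) by (simp add: dominating_set_def)
  show ?thesis
  proof (rule domination_number_eqI)
    show "dominating_set (map_graph \<phi> K) (\<phi> ` D)" using D(1) DV dominating_set_map_graph by blast
    show "card (\<phi> ` D) \<le> domination_number K" using D(2) DV card by simp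
    show "domination_number K \<le> card D'" if D': "dominating_set (map_graph \<phi> K) D'" for D'
    proof -
      obtain E where E: "E \<subseteq> pverts K" "D' = \<phi> ` E"
        using D' by (auto simp: dominating_set_def subset_image_iff)
      then have "dominating_set K E" using D' dominating_set_map_graph by blast
      then show ?thesis using E card domination_number_le[OF K.pair_finite_verts] by simp
    qed
  qed (simp add: K.pair_finite_verts)
qed

text \<open>The Perron vector of \<open>K\<close>, carried along \<phi>, is a positive eigenvector
  of the copy, and a positive eigenvector determines the spectral radius.\<close>

lemma spectral_radius_map_graph: "graph_spectral_radius (map_graph \<phi> K) = graph_spectral_radius K"
proof -
  interpret M: connected_graph "map_graph \<phi> K" by (rule connected_map_graph)
  obtain f where f: "\<And>v. v \<in> pverts K \<Longrightarrow> 0 < f v"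
    "\<And>v. v \<in> pverts K \<Longrightarrow> (\<Sum>u \<in> nbrs K v. f u) = graph_spectral_radius K * f v"
    using K.perron_vector by blast
  define g where "g = f \<circ> the_inv_into (pverts K) \<phi>"
  have g: "g (\<phi> v) = f v" if "v \<in> pverts K" for v
    using that inj by (simp add: g_def the_inv_into_f_f)
  have nb: "nbrs (map_graph \<phi> K) (\<phi> v) = \<phi> ` nbrs K v" if "v \<in> pverts K" for v
  proof
    show "nbrs (map_graph \<phi> K) (\<phi> v) \<subseteq> \<phi> ` nbrs K v"
    proof
      fix x assume "x \<in> nbrs (map_graph \<phi> K) (\<phi> v)"
      then obtain a b where ab: "(a, b) \<in> parcs K" "\<phi> a = \<phi> v" "x = \<phi> b"
        by (auto simp: nbrs_def)
      then have "a = v" using inj_onD[OF inj] K.in_arcsD1 that by blast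
      then show "x \<in> \<phi> ` nbrs K v" using ab by (auto simp: nbrs_def)
    qed
    show "\<phi> ` nbrs K v \<subseteq> nbrs (map_graph \<phi> K) (\<phi> v)" by (auto simp: nbrs_def)
  qed
  show ?thesis
  proof (rule M.spectral_radius_eqI[where f = g])
    show "0 < g v" if "v \<in> pverts (map_graph \<phi> K)" for v using that g f(1) by auto
    show "(\<Sum>u \<in> nbrs (map_graph \<phi> K) v. g u) = graph_spectral_radius K * g v"
      if v: "v \<in> pverts (map_graph \<phi> K)" for v
    proof -
      obtain w where w: "w \<in> pverts K" "v = \<phi> w" using v by auto
      have "inj_on \<phi> (nbrs K w)" using inj K.nbrs_subset by (meson inj_on_subset)
      then have "(\<Sum>u \<in> nbrs (map_graph \<phi> K) v. g u) = (\<Sum>u \<in> nbrs K w. g (\<phi> u))"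
        unfolding w(2) nb[OF w(1)] by (simp add: sum.reindex)
      also have "\<dots> = (\<Sum>u \<in> nbrs K w. f u)" using g K.nbrs_subset by (intro sum.cong) auto
      finally show ?thesis using f(2) g w by simp
    qed
  qed
qed

end

section \<open>Minimisers of the spectral radius\<close>

locale minimal_graph =
  fixes G :: "'a pair_pre_digraph" and n d :: nat
  assumes mem: "G \<in> graphs_order_domination n d"
    and minimal: "\<And>H :: 'a pair_pre_digraph. H \<in> graphs_order_domination n d \<Longrightarrow>
      graph_spectral_radius G \<le> graph_spectral_radius H"
begin

sublocale connected_graph G
  using mem by (simp add: graphs_order_domination_def connected_graph_def connected_graph_axioms_def)

lemma card_verts: "card (pverts G) = n" and domination: "domination_number G = d"
  using mem by (simp_all add: graphs_order_domination_def)

lemma map_graph_mem: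
  assumes "connected_graph K" "bij_betw \<phi> (pverts K) (pverts G)" "domination_number K = d"
  shows "map_graph \<phi> K \<in> graphs_order_domination n d"
proof -
  have inj: "inj_on \<phi> (pverts K)" "\<phi> ` pverts K = pverts G"
    using assms(2) by (auto simp: bij_betw_def)
  show ?thesis
    using connected_map_graph[OF assms(1) inj(1)] domination_number_map_graph[OF assms(1) inj(1)]
      assms(3) card_verts inj(2)
    by (simp add: graphs_order_domination_def connected_graph_def connected_graph_axioms_def)
qed

text \<open>Minimality compares only graphs over the vertex type of \<open>G\<close>, whereas the
  models live on the natural numbers. The model is therefore first copied onto the vertices of
  \<open>G\<close>.\<close>

lemma spectral_radius_le_model:
  fixes K :: "nat pair_pre_digraph"
  assumes K: "connected_graph K" "card (pverts K) = n" "domination_number K = d"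
  shows "graph_spectral_radius G \<le> graph_spectral_radius K"
proof -
  interpret K: connected_graph K by fact
  obtain \<phi> where \<phi>: "bij_betw \<phi> (pverts K) (pverts G)"
    using finite_same_card_bij[OF K.pair_finite_verts pair_finite_verts] K(2) card_verts by auto
  then show ?thesis
    using minimal[OF map_graph_mem[OF K(1) \<phi> K(3)]] spectral_radius_map_graph[OF K(1), of \<phi>]
    by (simp add: bij_betw_def)
qed

text \<open>If \<open>G\<close> had an arc beyond those of the copy of \<open>K\<close>, the copy
  would be a competitor with strictly smaller spectral radius.\<close>

lemma isomorphic_if_spanning:
  assumes K: "connected_graph K" "domination_number K = d"
    and \<phi>: "bij_betw \<phi> (pverts K) (pverts G)"
    and arcs: "\<And>u v. (u, v) \<in> parcs K \<Longrightarrow> (\<phi> u, \<phi> v) \<in> parcs G"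
  shows "graph_isomorphic G K"
proof -
  have inj: "inj_on \<phi> (pverts K)" "\<phi> ` pverts K = pverts G" using \<phi> by (auto simp: bij_betw_def)
  let ?M = "map_graph \<phi> K"
  have "parcs ?M = parcs G"
  proof (rule ccontr)
    assume "parcs ?M \<noteq> parcs G"
    then have "parcs ?M \<subset> parcs G" using arcs by auto
    then have "graph_spectral_radius ?M < graph_spectral_radius G"
      using connected_map_graph[OF K(1) inj(1)] inj(2)
      by (intro spectral_radius_subgraph_less) (auto simp: connected_graph_axioms)
    then show False using minimal[OF map_graph_mem[OF K(1) \<phi> K(2)]] by simp
  qed
  then have "G = ?M" using inj(2) by (intro pair_pre_digraph.equality) simp_all
  then have "graph_isomorphic K G" using map_graph_isomorphic[OF K(1) inj(1)] by simp
  moreover have "wf_digraph (with_proj K)"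
    using K(1) by (simp add: wf_digraph_wp_iff connected_graph_def pair_graph_def pair_digraph_def pair_fin_digraph_def)
  ultimately show ?thesis unfolding graph_isomorphic_def by (metis digraph_iso_swap)
qed

lemma isomorphic_if_spanning_list:
  assumes K: "connected_graph K" "domination_number K = d" "pverts K = {..<n}"
    and vs: "distinct vs" "set vs = pverts G"
    and arcs: "\<And>u v. (u, v) \<in> parcs K \<Longrightarrow> (vs ! u, vs ! v) \<in> parcs G"
  shows "graph_isomorphic G K"
proof (rule isomorphic_if_spanning[OF K(1,2)])
  have "length vs = n" using vs card_verts by (metis distinct_card)
  then show "bij_betw ((!) vs) (pverts K) (pverts G)"
    unfolding K(3) using vs by (simp add: bij_betw_nth)
qed (rule arcs)

end

section \<open>Stars\<close>

lemma connected_star_graph: "0 < n \<Longrightarrow> connected_graph (star_graph n)"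
  by (rule connected_if_smaller_nbr[where n = n, OF pair_graph_star_graph])
    (auto simp: star_graph_def Let_def)

lemma domination_number_star_graph: "0 < n \<Longrightarrow> domination_number (star_graph n) = 1"
proof (rule domination_number_eqI)
  assume n: "0 < n"
  show "dominating_set (star_graph n) {0}"
    using n by (auto simp: dominating_set_def star_graph_def Let_def)
  show "1 \<le> card D" if D: "dominating_set (star_graph n) D" for D
  proof -
    have "D \<noteq> {}" using D n by (auto simp: dominating_set_def star_graph_def Let_def)
    moreover have "finite D"
      using D by (auto simp: dominating_set_def star_graph_def Let_def intro: finite_subset)
    ultimately show ?thesis by (simp add: Suc_le_eq card_gt_0_iff)
  qed
qed (auto simp: star_graph_def Let_def)

lemma (in minimal_graph) order_pos: "0 < n"
  using card_verts nonempty pair_finite_verts by (auto simp: card_gt_0_iff)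

lemma (in minimal_graph) isomorphic_star_graph:
  assumes "d = 1"
  shows "graph_isomorphic G (star_graph n)"
proof -
  obtain D where D: "dominating_set G D" "card D = 1"
    using domination_number_attained[OF pair_finite_verts] domination assms by metis
  then obtain c where c: "D = {c}" by (meson card_1_singletonE)
  obtain xs where xs: "distinct xs" "set xs = pverts G - {c}"
    using finite_distinct_list[of "pverts G - {c}"] pair_finite_verts by auto
  have cV: "c \<in> pverts G" and adj: "\<And>v. v \<in> pverts G - {c} \<Longrightarrow> (c, v) \<in> parcs G"
    using D c by (auto simp: dominating_set_def)
  have len: "length (c # xs) = n"
    using xs cV card_verts pair_finite_verts by (metis distinct_card distinct.simps(2) DiffD2 insert_Diff insertI1 list.simps(15))
  show ?thesis
  proof (rule isomorphic_if_spanning_list)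
    show "distinct (c # xs)" "set (c # xs) = pverts G" using xs cV by auto
    have arc: "(c, (c # xs) ! i) \<in> parcs G" if "1 \<le> i" "i < n" for i
      using that len xs(2) nth_mem[of "i - 1" xs] by (intro adj) (auto simp: nth_Cons')
    show "((c # xs) ! u, (c # xs) ! v) \<in> parcs G" if "(u, v) \<in> parcs (star_graph n)" for u v
      using that arc arcs_symmetric by (auto simp: star_graph_def Let_def)
  qed (use order_pos assms connected_star_graph domination_number_star_graph in
      \<open>auto simp: star_graph_def Let_def\<close>)
qed

section \<open>Paths and spiders\<close>

lemma pverts_path_graph [simp]: "pverts (path_graph n) = {..<n}"
  by (simp add: path_graph_def Let_def)

lemma parcs_path_graph_iff:
  "(u, v) \<in> parcs (path_graph n) \<longleftrightarrow> (v = Suc u \<and> v < n) \<or> (u = Suc v \<and> u < n)"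
  by (auto simp: path_graph_def Let_def)

lemma connected_path_graph: "0 < n \<Longrightarrow> connected_graph (path_graph n)"
proof (rule connected_if_smaller_nbr[where n = n, OF pair_graph_path_graph])
  show "\<exists>u < v. (u, v) \<in> parcs (path_graph n)" if "0 < v" "v < n" for v
    using that by (intro exI[of _ "v - 1"]) (auto simp: parcs_path_graph_iff)
qed auto

text \<open>A vertex of a path dominates at most three vertices, itself included, which gives the
  lower bound.\<close>

lemma domination_number_path_graph: "domination_number (path_graph n) = (n + 2) div 3"
proof (rule domination_number_eqI)
  \<comment> \<open>The middle vertices of consecutive triples. The minimum takes effect only if
    \<open>n\<close> leaves remainder 1 modulo 3, when the last block is a single vertex.\<close>
  let ?D = "(\<lambda>j. min (3 * j + 1) (n - 1)) ` {..<(n + 2) div 3}"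
  show "card ?D \<le> (n + 2) div 3" using card_image_le[of "{..<(n + 2) div 3}"] by fastforce
  show "dominating_set (path_graph n) ?D"
    unfolding dominating_set_def
  proof (intro conjI ballI)
    show "?D \<subseteq> pverts (path_graph n)" by auto
    fix v assume v: "v \<in> pverts (path_graph n) - ?D"
    define u where "u = min (3 * (v div 3) + 1) (n - 1)"
    have "v div 3 < (n + 2) div 3" using v by auto
    then have u: "u \<in> ?D" unfolding u_def by blast
    then have "u \<noteq> v" using v by auto
    moreover have "v = 3 * (v div 3) + v mod 3" "v mod 3 < 3" by auto
    ultimately have "(u, v) \<in> parcs (path_graph n)"
      using v unfolding u_def parcs_path_graph_iff by auto
    then show "\<exists>u \<in> ?D. (u, v) \<in> parcs (path_graph n)" using u by blast
  qed
  show "(n + 2) div 3 \<le> card D" if D: "dominating_set (path_graph n) D" for D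
  proof -
    have fin: "finite D" using D by (auto simp: dominating_set_def intro: finite_subset)
    have "{..<n} \<subseteq> (\<Union>u \<in> D. {u - 1, u, u + 1})"
    proof
      fix v assume v: "v \<in> {..<n}"
      show "v \<in> (\<Union>u \<in> D. {u - 1, u, u + 1})"
      proof (cases "v \<in> D")
        case False
        then obtain u where "u \<in> D" "(u, v) \<in> parcs (path_graph n)"
          using D v by (auto simp: dominating_set_def)
        then show ?thesis by (intro UN_I[of u]) (auto simp: parcs_path_graph_iff)
      qed auto
    qed
    then have "n \<le> card (\<Union>u \<in> D. {u - 1, u, u + 1})"
      using card_mono[of "\<Union>u \<in> D. {u - 1, u, u + 1}" "{..<n}"] fin by simp
    also have "\<dots> \<le> (\<Sum>u \<in> D. card {u - 1, u, u + 1})" by (rule card_UN_le[OF fin])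
    also have "\<dots> \<le> (\<Sum>u \<in> D. 3)" by (intro sum_mono) (simp add: card_insert_if)
    finally show ?thesis by simp
  qed
qed auto

text \<open>The sine vector is positive on the path and vanishes one place before its start and one
  place after its end, so the addition theorem gives an eigenvector.\<close>

lemma spectral_radius_path_graph_le:
  assumes "0 < n"
  shows "graph_spectral_radius (path_graph n) \<le> 2 * cos (pi / (n + 1))"
proof -
  interpret P: connected_graph "path_graph n" using assms by (rule connected_path_graph)
  define \<theta> where "\<theta> = pi / (n + 1)"
  have \<theta>: "0 < \<theta>" "(n + 1) * \<theta> = pi" by (simp_all add: \<theta>_def)
  define f where "f v = sin ((real v + 1) * \<theta>)" for v
  have "graph_spectral_radius (path_graph n) \<le> 2 * cos \<theta>"
  proof (rule P.spectral_radius_le)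
    fix v assume "v \<in> pverts (path_graph n)"
    then have v: "v < n" by simp
    have "(real v + 1) * \<theta> < (n + 1) * \<theta>" using v \<theta>(1) by (intro mult_strict_right_mono) auto
    then show "0 < f v" unfolding f_def \<theta>(2) using \<theta>(1) by (intro sin_gt_zero) auto
    have "(\<Sum>u \<in> nbrs (path_graph n) v. f u) = sin (v * \<theta>) + sin ((real v + 2) * \<theta>)"
    proof -
      \<comment> \<open>Left and right neighbour are summed separately. At an end of the path one of
        the sets is empty, and the corresponding sine is zero.\<close>
      have "nbrs (path_graph n) v = {u. v = Suc u} \<union> {u. u = Suc v \<and> u < n}"
        using v by (auto simp: nbrs_def parcs_path_graph_iff)
      also have "sum f \<dots> = sum f {u. v = Suc u} + sum f {u. u = Suc v \<and> u < n}"
        by (rule sum.union_disjoint) (auto intro: finite_subset[of _ "{v - 1}"])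
      also have "sum f {u. v = Suc u} = sin (v * \<theta>)"
        by (cases v) (auto simp: f_def add.commute)
      also have "sum f {u. u = Suc v \<and> u < n} = sin ((real v + 2) * \<theta>)"
      proof (cases "Suc v < n")
        case True
        then have "{u. u = Suc v \<and> u < n} = {Suc v}" by auto
        then show ?thesis by (simp add: f_def algebra_simps)
      next
        case False
        then have "real v + 2 = real n + 1" using v by linarith
        then have "sin ((real v + 2) * \<theta>) = sin ((n + 1) * \<theta>)" by (simp only: of_nat_add of_nat_1)
        then have "sin ((real v + 2) * \<theta>) = 0" unfolding \<theta>(2) by simp
        moreover have "{u. u = Suc v \<and> u < n} = {}" using False by auto
        ultimately show ?thesis by (simp only: sum.empty)
      qed
      finally show ?thesis .
    qed
    also have "\<dots> = sin ((real v + 1) * \<theta> - \<theta>) + sin ((real v + 1) * \<theta> + \<theta>)"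
      by (simp add: algebra_simps)
    also have "\<dots> = 2 * cos \<theta> * f v" by (simp add: f_def sin_diff sin_add)
    finally show "(\<Sum>u \<in> nbrs (path_graph n) v. f u) \<le> 2 * cos \<theta> * f v" by simp
  qed
  then show ?thesis by (simp add: \<theta>_def)
qed

section \<open>Paths in graphs, and a bound from degrees\<close>

context connected_graph
begin

definition path :: "'a list \<Rightarrow> bool" where
  "path p \<longleftrightarrow> distinct p \<and> set p \<subseteq> pverts G \<and> successively (\<lambda>u v. v \<in> nbrs G u) p"

lemma path_nth_adj: "path p \<Longrightarrow> Suc i < length p \<Longrightarrow> p ! Suc i \<in> nbrs G (p ! i)"
  by (simp add: path_def successively_conv_nth)

lemma path_length_le: "path p \<Longrightarrow> length p \<le> card (pverts G)"
  unfolding path_def by (metis card_mono distinct_card pair_finite_verts)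

lemma path_snoc:
  "path p \<Longrightarrow> p \<noteq> [] \<Longrightarrow> w \<in> nbrs G (last p) \<Longrightarrow> w \<notin> set p \<Longrightarrow> path (p @ [w])"
  using nbrs_subset by (auto simp: path_def successively_append_iff)

lemma path_Cons:
  "path p \<Longrightarrow> p \<noteq> [] \<Longrightarrow> w \<in> nbrs G (hd p) \<Longrightarrow> w \<notin> set p \<Longrightarrow> path (w # p)"
  using nbrs_subset nbrs_sym by (cases p) (auto simp: path_def)

lemma card_nbrs_ge:
  assumes "distinct xs" "set xs \<subseteq> nbrs G v"
  shows "length xs \<le> card (nbrs G v)"
  using assms by (metis card_mono distinct_card finite_nbrs)

text \<open>Take a longest path. If an arc leaves it, then from an end vertex the path could be
  prolonged, and from an inner vertex the arc would give a third neighbour.\<close>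

lemma ex_hamiltonian_path:
  assumes deg: "\<And>v. v \<in> pverts G \<Longrightarrow> card (nbrs G v) \<le> 2"
  shows "\<exists>p. path p \<and> set p = pverts G"
proof -
  obtain v0 where v0: "v0 \<in> pverts G" using nonempty by blast
  then have "path [v0]" by (simp add: path_def)
  then obtain p where p: "path p" "\<And>q. path q \<Longrightarrow> length q \<le> length p"
    using ex_has_greatest_nat[of path "[v0]" length "Suc (card (pverts G))"] path_length_le
    by (metis le_imp_less_Suc)
  have ne: "p \<noteq> []" using p(2)[OF \<open>path [v0]\<close>] by auto
  have "set p = pverts G"
  proof (rule ccontr)
    assume "set p \<noteq> pverts G"
    then have "set p \<noteq> {}" "set p \<subset> pverts G" using ne p(1) by (auto simp: path_def)
    then obtain u w where uw: "u \<in> set p" "w \<in> pverts G - set p" "w \<in> nbrs G u" by (rule cut_arc)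
    then obtain i where i: "i < length p" "u = p ! i" by (metis in_set_conv_nth)
    consider "i = 0" | "Suc i = length p" | j where "i = Suc j" "Suc i < length p"
      using i(1) by (metis Suc_lessI not0_implies_Suc)
    then show False
    proof cases
      case 1
      then have "path (w # p)" using path_Cons[OF p(1) ne] uw i ne by (simp add: hd_conv_nth)
      then show False using p(2) by fastforce
    next
      case 2
      then have "u = last p" using i ne by (metis diff_Suc_1 last_conv_nth)
      then have "path (p @ [w])" using path_snoc[OF p(1) ne] uw by simp
      then show False using p(2) by fastforce
    next
      case 3
      have "p ! j \<in> nbrs G u" "p ! Suc i \<in> nbrs G u"
        using path_nth_adj[OF p(1), of j] path_nth_adj[OF p(1), of i] 3 i nbrs_sym by auto
      moreover have "distinct [p ! j, p ! Suc i, w]"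
        using p(1) 3 uw(2) by (auto simp: path_def nth_eq_iff_index_eq)
      ultimately have "3 \<le> card (nbrs G u)" using card_nbrs_ge[of "[p ! j, p ! Suc i, w]" u] uw by simp
      moreover have "u \<in> pverts G" using uw(1) p(1) by (auto simp: path_def)
      ultimately show False using deg[of u] by simp
    qed
  qed
  then show ?thesis using p(1) by blast
qed

text \<open>The vector which is 2 on \<open>S\<close> and 1 on its neighbours is a subsolution.\<close>

lemma two_le_spectral_radius:
  assumes S: "S \<noteq> {}" "S \<subseteq> pverts G"
    and deg: "\<And>u. u \<in> S \<Longrightarrow> 4 \<le> card (nbrs G u) + card (nbrs G u \<inter> S)"
  shows "2 \<le> graph_spectral_radius G"
proof -
  define f :: "'a \<Rightarrow> real" where
    "f v = (if v \<in> S then 2 else if nbrs G v \<inter> S \<noteq> {} then 1 else 0)" for v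
  obtain z where z: "z \<in> S" using S by blast
  show ?thesis
  proof (rule spectral_radius_ge(1)[where f = f and z = z])
    fix v assume "v \<in> pverts G"
    consider "v \<in> S" | "v \<notin> S" "nbrs G v \<inter> S \<noteq> {}" | "v \<notin> S" "nbrs G v \<inter> S = {}" by blast
    then show "2 * f v \<le> (\<Sum>u \<in> nbrs G v. f u)"
    proof cases
      case 1
      \<comment> \<open>Neighbours inside \<open>S\<close> contribute 2 and all others 1, so the
        degree hypothesis says precisely that this total is at least 4, which is twice
        \<open>f v\<close>.\<close>
      have "(\<Sum>u \<in> nbrs G v. 1 + (if u \<in> S then 1 else 0)) \<le> (\<Sum>u \<in> nbrs G v. f u)"
        using 1 nbrs_sym by (intro sum_mono) (auto simp: f_def)
      moreover have "(\<Sum>u \<in> nbrs G v. 1 + (if u \<in> S then 1 else 0 :: real))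
          = card (nbrs G v) + card (nbrs G v \<inter> S)"
        by (simp add: sum.distrib sum.If_cases)
      ultimately show ?thesis using deg[OF 1] 1 by (simp add: f_def)
    next
      case 2
      then obtain u where u: "u \<in> nbrs G v" "u \<in> S" by blast
      then have "f u \<le> (\<Sum>u \<in> nbrs G v. f u)" by (intro member_le_sum) (auto simp: f_def)
      then show ?thesis using u 2 by (simp add: f_def)
    next
      case 3
      then show ?thesis by (auto simp: f_def intro!: sum_nonneg)
    qed
  qed (use z S in \<open>auto simp: f_def\<close>)
qed

end

section \<open>Spiders with three legs\<close>

lemma dropWhile_neq_nth:
  "distinct xs \<Longrightarrow> i < length xs \<Longrightarrow> dropWhile (\<lambda>y. y \<noteq> xs ! i) xs = drop i xs"
proof (induction xs arbitrary: i)
  case (Cons x xs)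
  then show ?case by (cases i) auto
qed simp

text \<open>With \<open>\<alpha> = (a + 1) \<theta>\<close>, \<open>\<beta> = (b + 1) \<theta>\<close> and \<open>(c + 1) \<theta> = \<pi> + \<theta> - \<alpha> - \<beta>\<close> the difference of the
  two sides is \<open>sin (\<alpha> - \<theta>) sin (\<beta> - \<theta>) sin (\<alpha> + \<beta>) / (sin \<alpha> sin \<beta> sin (\<alpha> + \<beta> - \<theta>))\<close>.\<close>

lemma spider_centre_inequality:
  fixes a b c :: nat and \<theta> :: real
  assumes "0 < a" "0 < b" "0 < c" and \<theta>: "\<theta> = pi / (a + b + c + 2)"
  shows "2 * cos \<theta> < sin (a * \<theta>) / sin ((a + 1) * \<theta>) + sin (b * \<theta>) / sin ((b + 1) * \<theta>)
    + sin (c * \<theta>) / sin ((c + 1) * \<theta>)"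
proof -
  define \<alpha> \<beta> where "\<alpha> = (a + 1) * \<theta>" and "\<beta> = (b + 1) * \<theta>"
  have pos: "0 < sin (k * \<theta>)" if "0 < k" "k < a + b + c + 2" for k :: nat
  proof -
    have "0 < \<theta>" using \<theta> by simp
    moreover have "real k * \<theta> < real (a + b + c + 2) * \<theta>"
      using that \<open>0 < \<theta>\<close> by (intro mult_strict_right_mono) auto
    then have "real k * \<theta> < pi" using \<theta> by simp
    ultimately show ?thesis using that by (intro sin_gt_zero) auto
  qed
  have sum: "(real a + b + c + 2) * \<theta> = pi" using \<theta> by (simp add: add_ac)
  have a: "a * \<theta> = \<alpha> - \<theta>" and b: "b * \<theta> = \<beta> - \<theta>" by (simp_all add: \<alpha>_def \<beta>_def algebra_simps)
  have "(c + 1) * \<theta> = pi - (\<alpha> + \<beta> - \<theta>)" "c * \<theta> = pi - (\<alpha> + \<beta>)"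
    using sum by (simp_all add: \<alpha>_def \<beta>_def algebra_simps)
  then have c: "sin ((c + 1) * \<theta>) = sin (\<alpha> + \<beta> - \<theta>)" "sin (c * \<theta>) = sin (\<alpha> + \<beta>)" by simp_all
  have p: "0 < sin \<alpha>" "0 < sin \<beta>" "0 < sin (\<alpha> + \<beta> - \<theta>)"
    "0 < sin (\<alpha> - \<theta>)" "0 < sin (\<beta> - \<theta>)" "0 < sin (\<alpha> + \<beta>)"
    using pos[of "a + 1"] pos[of "b + 1"] pos[of "c + 1"] pos[of a] pos[of b] pos[of c] assms
    unfolding c a b by (simp_all add: \<alpha>_def \<beta>_def c[symmetric])
  \<comment> \<open>The claimed difference after clearing denominators. The three terms with
    numerators other than \<open>sin (\<alpha> + \<beta>)\<close> collapse to a multiple of it, and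
    \<open>key\<close> evaluates the remaining factor.\<close>
  have id: "sin (\<alpha> - \<theta>) * sin \<beta> * sin (\<alpha> + \<beta> - \<theta>) + sin (\<beta> - \<theta>) * sin \<alpha> * sin (\<alpha> + \<beta> - \<theta>)
      + sin (\<alpha> + \<beta>) * sin \<alpha> * sin \<beta> - 2 * cos \<theta> * sin \<alpha> * sin \<beta> * sin (\<alpha> + \<beta> - \<theta>)
    = sin (\<alpha> - \<theta>) * sin (\<beta> - \<theta>) * sin (\<alpha> + \<beta>)" (is "?L = _")
  proof -
    have P: "sin (\<alpha> - \<theta>) = sin \<alpha> * cos \<theta> - cos \<alpha> * sin \<theta>"
      and Q: "sin (\<beta> - \<theta>) = sin \<beta> * cos \<theta> - cos \<beta> * sin \<theta>"
      and R: "sin (\<alpha> + \<beta>) = sin \<alpha> * cos \<beta> + cos \<alpha> * sin \<beta>"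
      by (simp_all add: sin_diff sin_add)
    have D: "sin (\<alpha> + \<beta> - \<theta>) = (sin \<alpha> * cos \<beta> + cos \<alpha> * sin \<beta>) * cos \<theta>
        - (cos \<alpha> * cos \<beta> - sin \<alpha> * sin \<beta>) * sin \<theta>"
      by (simp add: sin_diff sin_add cos_add)
    have C: "cos \<theta> * cos \<theta> = 1 - sin \<theta> * sin \<theta>"
      using sin_cos_squared_add[of \<theta>] by (simp add: power2_eq_square)
    have "sin (\<alpha> - \<theta>) * sin (\<beta> - \<theta>) = sin \<alpha> * sin \<beta> * (cos \<theta> * cos \<theta>)
        - sin \<theta> * cos \<theta> * (sin \<alpha> * cos \<beta> + cos \<alpha> * sin \<beta>) + cos \<alpha> * cos \<beta> * sin \<theta> * sin \<theta>"
      by (simp add: P Q algebra_simps)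
    also have "\<dots> = sin \<alpha> * sin \<beta> - sin \<theta> * sin (\<alpha> + \<beta> - \<theta>)"
      unfolding C D by (simp add: algebra_simps)
    finally have key: "sin (\<alpha> - \<theta>) * sin (\<beta> - \<theta>) = sin \<alpha> * sin \<beta> - sin \<theta> * sin (\<alpha> + \<beta> - \<theta>)" .
    have "?L = (sin \<alpha> * sin \<beta> - sin \<theta> * sin (\<alpha> + \<beta> - \<theta>)) * sin (\<alpha> + \<beta>)"
      unfolding P Q R by (simp add: algebra_simps)
    then show ?thesis by (simp only: key)
  qed
  have "sin (\<alpha> - \<theta>) / sin \<alpha> + sin (\<beta> - \<theta>) / sin \<beta> + sin (\<alpha> + \<beta>) / sin (\<alpha> + \<beta> - \<theta>) - 2 * cos \<theta>
    = sin (\<alpha> - \<theta>) * sin (\<beta> - \<theta>) * sin (\<alpha> + \<beta>) / (sin \<alpha> * sin \<beta> * sin (\<alpha> + \<beta> - \<theta>))"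
    unfolding id[symmetric] using p(1-3) by (simp add: field_simps)
  moreover have "\<dots> > 0" using p by simp
  ultimately show ?thesis unfolding a b c \<alpha>_def[symmetric] \<beta>_def[symmetric] by linarith
qed

context connected_graph
begin

definition spider :: "'a \<Rightarrow> (nat \<Rightarrow> 'a list) \<Rightarrow> bool" where
  "spider v P \<longleftrightarrow> (\<forall>i < 3. P i \<noteq> [] \<and> path (v # P i)) \<and>
     (\<forall>i < 3. \<forall>j < 3. i \<noteq> j \<longrightarrow> set (P i) \<inter> set (P j) = {})"

lemma spider_inj: "spider v P \<Longrightarrow> inj_on (\<lambda>i. P i ! 0) {..<3}"
  unfolding spider_def inj_on_def
  by (metis IntI empty_iff length_greater_0_conv lessThan_iff nth_mem)

lemma spider_nbrs: "spider v P \<Longrightarrow> i < 3 \<Longrightarrow> P i ! 0 \<in> nbrs G v"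
  using path_nth_adj[of "v # P i" 0] by (simp add: spider_def)

text \<open>On each arm take a sine wave scaled to 1 at the centre and vanishing one place past the
  tip. It meets the bound along the arms, and \<open>spider_centre_inequality\<close> makes it
  strict at the centre.\<close>

lemma spectral_radius_spanning_spider:
  assumes spider: "spider v P" and span: "insert v (\<Union>i < 3. set (P i)) = pverts G"
  shows "2 * cos (pi / (card (pverts G) + 1)) < graph_spectral_radius G"
proof -
  define q where "q i = v # P i" for i
  have q: "path (q i)" "P i \<noteq> []" if "i < 3" for i using spider that by (auto simp: spider_def q_def)
  have dist: "distinct (q i)" if "i < 3" for i using q(1)[OF that] by (simp add: path_def)
  have disj: "set (P i) \<inter> set (P j) = {}" if "i < 3" "j < 3" "i \<noteq> j" for i j
    using spider that by (simp add: spider_def)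
  have vP: "v \<notin> set (P i)" if "i < 3" for i using dist[OF that] by (simp add: q_def)
  have three: "{..<3} = {0, 1, 2 :: nat}" by auto
  define \<theta> where "\<theta> = pi / (card (pverts G) + 1)"
  have "card (\<Union>i < 3. set (P i)) = (\<Sum>i < 3. card (set (P i)))"
    using disj by (intro card_UN_disjoint) auto
  also have "\<dots> = (\<Sum>i < 3. length (P i))"
    using dist by (intro sum.cong) (auto simp: q_def distinct_card)
  finally have "card (pverts G) = 1 + (\<Sum>i < 3. length (P i))"
    unfolding span[symmetric] using vP by simp
  then have n: "card (pverts G) = 1 + length (P 0) + length (P 1) + length (P 2)"
    by (simp add: three)
  have \<theta>: "0 < \<theta>" "\<theta> = pi / (length (P 0) + length (P 1) + length (P 2) + 2)"
    by (simp_all add: \<theta>_def n add_ac)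
  have lt: "length (q i) < card (pverts G) + 1" if "i < 3" for i
    using path_length_le[OF q(1)[OF that]] by simp
  have pos: "0 < sin (k * \<theta>)" if "0 < k" "k < card (pverts G) + 1" for k :: nat
  proof -
    have "real k * \<theta> < real (card (pverts G) + 1) * \<theta>"
      using that \<theta>(1) by (intro mult_strict_right_mono) auto
    also have "\<dots> = pi" by (simp add: \<theta>_def)
    finally show ?thesis using that \<theta>(1) by (intro sin_gt_zero) auto
  qed
  \<comment> \<open>The suffix of \<open>q i\<close> starting at \<open>x\<close> has as its length
    the distance from \<open>x\<close> to the place past the tip. Off the arm the suffix is empty
    and the sine is zero, so the arms can simply be added. Only the centre lies on all three and is
    treated apart.\<close>
  define arm where
    "arm i x = sin (length (dropWhile (\<lambda>y. y \<noteq> x) (q i)) * \<theta>) / sin (length (q i) * \<theta>)" for i x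
  define f where "f x = (if x = v then 1 else \<Sum>i < 3. arm i x)" for x
  have arm_0: "arm i x = 0" if "x \<notin> set (q i)" for i x
  proof -
    have "dropWhile (\<lambda>y. y \<noteq> x) (q i) = []" using that by auto
    then show ?thesis by (simp only: arm_def) simp
  qed
  have arm_nonneg: "0 \<le> arm i x" if "i < 3" for i x
  proof -
    let ?k = "length (dropWhile (\<lambda>y. y \<noteq> x) (q i))"
    have "?k \<le> length (q i)" by (rule length_dropWhile_le)
    then have "0 \<le> sin (?k * \<theta>)"
      using pos[of ?k] lt[OF that] by (cases "?k = 0") (auto simp del: length_0_conv)
    moreover have "0 < sin (length (q i) * \<theta>)" using lt[OF that] by (intro pos) (auto simp: q_def)
    ultimately show ?thesis by (simp add: arm_def)
  qed
  have f_nonneg: "0 \<le> f x" for x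
    unfolding f_def using arm_nonneg by (auto intro: sum_nonneg)
  have f_nth: "f (q i ! k) = sin ((length (q i) - k) * \<theta>) / sin (length (q i) * \<theta>)"
    if ik: "i < 3" "k < length (q i)" for i k
  proof (cases k)
    case 0
    have "0 < sin (length (q i) * \<theta>)" using lt[OF ik(1)] by (intro pos) (auto simp: q_def)
    then show ?thesis using 0 by (simp add: f_def q_def)
  next
    case (Suc k')
    let ?x = "q i ! k"
    have x: "?x \<in> set (P i)" "?x \<noteq> v" using ik Suc vP[OF ik(1)] by (auto simp: q_def)
    have "(\<Sum>j < 3. arm j ?x) = (\<Sum>j < 3. if j = i then arm i ?x else 0)"
    proof (intro sum.cong refl)
      fix j :: nat assume j: "j \<in> {..<3}"
      have "?x \<notin> set (q j)" if "j \<noteq> i"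
        using x disj[OF ik(1), of j] j that unfolding q_def by auto
      then show "arm j ?x = (if j = i then arm i ?x else 0)" using arm_0 by simp
    qed
    also have "\<dots> = arm i ?x" using ik(1) by simp
    also have "\<dots> = sin ((length (q i) - k) * \<theta>) / sin (length (q i) * \<theta>)"
      unfolding arm_def dropWhile_neq_nth[OF dist[OF ik(1)] ik(2)] by simp
    finally show ?thesis using x by (simp add: f_def)
  qed
  have centre: "2 * cos \<theta> * f v < (\<Sum>u \<in> nbrs G v. f u)"
  proof -
    have "2 * cos \<theta> * f v < (\<Sum>i < 3. sin (length (P i) * \<theta>) / sin ((length (P i) + 1) * \<theta>))"
      using spider_centre_inequality[OF _ _ _ \<theta>(2)] q(2)[of 0] q(2)[of 1] q(2)[of 2]
      by (simp add: three f_def add_ac)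
    also have "\<dots> = (\<Sum>i < 3. f (P i ! 0))"
    proof (intro sum.cong refl)
      fix i :: nat assume "i \<in> {..<3}"
      then show "sin (length (P i) * \<theta>) / sin ((length (P i) + 1) * \<theta>) = f (P i ! 0)"
        using f_nth[of i 1] q(2)[of i] by (simp add: q_def add_ac)
    qed
    also have "\<dots> = (\<Sum>u \<in> (\<lambda>i. P i ! 0) ` {..<3}. f u)"
      by (simp add: sum.reindex[OF spider_inj[OF spider]])
    also have "\<dots> \<le> (\<Sum>u \<in> nbrs G v. f u)"
      using spider_nbrs[OF spider] f_nonneg by (intro sum_mono2) auto
    finally show ?thesis .
  qed
  have arms: "2 * cos \<theta> * f x \<le> (\<Sum>u \<in> nbrs G x. f u)" if x: "i < 3" "x \<in> set (P i)" for i x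
  proof -
    obtain j where j: "j < length (P i)" "x = P i ! j" using x by (metis in_set_conv_nth)
    \<comment> \<open>The number of vertices beyond \<open>x\<close> on its arm, since
      \<open>x\<close> has position \<open>Suc j\<close> in \<open>q i\<close>. For
      \<open>k = 0\<close> the wave is zero at the missing next place, so the previous vertex alone
      suffices.\<close>
    define k where "k = length (q i) - Suc (Suc j)"
    have L: "length (q i) = k + 2 + j" using j by (simp add: k_def q_def)
    have prev: "q i ! j \<in> nbrs G x"
      using path_nth_adj[OF q(1)[OF x(1)], of j] j nbrs_sym by (simp add: q_def)
    let ?s = "sin (length (q i) * \<theta>)"
    have fx: "f x = sin ((k + 1) * \<theta>) / ?s"
      using f_nth[OF x(1), of "Suc j"] j L by (simp add: q_def)
    have fp: "f (q i ! j) = sin ((k + 2) * \<theta>) / ?s"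
      using f_nth[OF x(1), of j] j L by (simp add: q_def)
    have "2 * cos \<theta> * sin ((real k + 1) * \<theta>)
        = sin ((real k + 1) * \<theta> + \<theta>) + sin ((real k + 1) * \<theta> - \<theta>)"
      by (simp add: sin_add sin_diff)
    also have "\<dots> = sin ((real k + 2) * \<theta>) + sin (k * \<theta>)" by (simp add: algebra_simps)
    finally have eq: "2 * cos \<theta> * f x = f (q i ! j) + sin (k * \<theta>) / ?s"
      unfolding fx fp by (simp add: add_divide_distrib[symmetric] add_ac)
    show ?thesis
    proof (cases "k = 0")
      case True
      then have "2 * cos \<theta> * f x = f (q i ! j)" using eq by simp
      also have "\<dots> \<le> (\<Sum>u \<in> nbrs G x. f u)" using prev f_nonneg by (intro member_le_sum) auto
      finally show ?thesis .
    next
      case False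
      then have j2: "Suc (Suc j) < length (q i)" using L by simp
      have "q i ! Suc (Suc j) \<in> nbrs G x"
        using path_nth_adj[OF q(1)[OF x(1)], of "Suc j"] j j2 by (simp add: q_def)
      moreover have "f (q i ! Suc (Suc j)) = sin (k * \<theta>) / ?s"
        using f_nth[OF x(1) j2] L by simp
      moreover have "q i ! j \<noteq> q i ! Suc (Suc j)"
        using dist[OF x(1)] j2 by (simp add: nth_eq_iff_index_eq)
      ultimately have "2 * cos \<theta> * f x = (\<Sum>u \<in> {q i ! j, q i ! Suc (Suc j)}. f u)"
        "{q i ! j, q i ! Suc (Suc j)} \<subseteq> nbrs G x"
        using eq prev by simp_all
      then show ?thesis using f_nonneg by (simp only:) (intro sum_mono2, auto)
    qed
  qed
  have "2 * cos \<theta> < graph_spectral_radius G"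
  proof (rule spectral_radius_ge(2)[where f = f and z = v and w = v])
    show "2 * cos \<theta> * f x \<le> (\<Sum>u \<in> nbrs G x. f u)" if "x \<in> pverts G" for x
      using that arms centre unfolding span[symmetric] by (auto intro: less_imp_le)
  qed (use centre f_nonneg span in \<open>auto simp: f_def\<close>)
  then show ?thesis by (simp add: \<theta>_def)
qed

text \<open>If a spider of maximal size does not span, then an arc leaving it starts at the centre or in
  the interior of an arm, and the part of the arm up to that vertex is an affine Dynkin diagram.\<close>

lemma spectral_radius_branching:
  assumes v: "v \<in> pverts G" "3 \<le> card (nbrs G v)"
  shows "2 * cos (pi / (card (pverts G) + 1)) < graph_spectral_radius G"
proof -
  let ?n = "card (pverts G)"
  obtain T where T: "T \<subseteq> nbrs G v" "card T = 3" using v(2) by (meson obtain_subset_with_card_n)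
  obtain xs where xs: "distinct xs" "set xs = T"
    using finite_distinct_list[of T] T finite_subset[OF _ finite_nbrs] by blast
  have len: "length xs = 3" using xs T(2) by (metis distinct_card)
  have "path [v, xs ! i]" if "i < 3" for i
  proof -
    have "xs ! i \<in> nbrs G v" using that len xs T by auto
    then show ?thesis using v nbrs_subset by (auto simp: path_def)
  qed
  then have "spider v (\<lambda>i. [xs ! i])"
    using xs len by (auto simp: spider_def nth_eq_iff_index_eq)
  moreover have bound: "(\<Sum>i < 3. length (P i)) < Suc (3 * ?n)" if "spider v P" for P
  proof -
    have "length (P i) \<le> ?n" if "i < 3" for i
      using path_length_le[of "v # P i"] \<open>spider v P\<close> that by (simp add: spider_def)
    then have "(\<Sum>i < 3. length (P i)) \<le> (\<Sum>i < (3 :: nat). ?n)" by (intro sum_mono) auto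
    then show ?thesis by simp
  qed
  ultimately obtain P where P: "spider v P"
    and max: "\<And>Q. spider v Q \<Longrightarrow> (\<Sum>i < 3. length (Q i)) \<le> (\<Sum>i < 3. length (P i))"
    using ex_has_greatest_nat[of "spider v" _ "\<lambda>P. \<Sum>i < 3. length (P i)" "Suc (3 * ?n)"] by blast
  define S where "S = insert v (\<Union>i < 3. set (P i))"
  have path: "path (v # P i)" "P i \<noteq> []" if "i < 3" for i using P that by (auto simp: spider_def)
  have SV: "S \<subseteq> pverts G" using path v by (auto simp: S_def path_def)
  show ?thesis
  proof (cases "S = pverts G")
    case True
    then show ?thesis using spectral_radius_spanning_spider P by (simp add: S_def)
  next
    case False
    then have "S \<noteq> {}" "S \<subset> pverts G" using SV by (auto simp: S_def)
    then obtain z w where zw: "z \<in> S" "w \<in> pverts G - S" "w \<in> nbrs G z" by (rule cut_arc)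
    \<comment> \<open>Each arm is read from the centre, which has position 0; if \<open>z\<close> is
      the centre, arm 0 serves.\<close>
    have "\<exists>i < 3. \<exists>m < length (v # P i). z = (v # P i) ! m"
    proof (cases "z = v")
      case True
      then show ?thesis by (intro exI[of _ 0]) auto
    next
      case False
      then obtain i where "i < 3" "z \<in> set (v # P i)" using zw(1) by (auto simp: S_def)
      then show ?thesis by (metis in_set_conv_nth)
    qed
    then obtain i m where im: "i < 3" "m < length (v # P i)" "z = (v # P i) ! m" by blast
    define q where "q = v # P i"
    have q: "path q" "distinct q" "set q \<subseteq> S"
      using path[OF im(1)] im(1) by (auto simp: q_def path_def S_def)
    \<comment> \<open>An arc leaving from the tip would lengthen this arm, against
      maximality.\<close>
    have m: "Suc m < length q"
    proof (rule ccontr)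
      assume "\<not> Suc m < length q"
      then have "m = length q - 1" using im(2) by (simp add: q_def)
      then have "z = last q" using im(3) by (simp add: q_def last_conv_nth)
      moreover have "w \<notin> set q" using q zw by blast
      ultimately have "path (q @ [w])" using path_snoc[OF q(1)] zw(3) by (simp add: q_def)
      then have "spider v (P(i := P i @ [w]))"
        using P zw(2) im(1) by (auto simp: spider_def q_def S_def)
      from max[OF this] have "(\<Sum>j < 3. length ((P(i := P i @ [w])) j)) \<le> (\<Sum>j < 3. length (P j))" .
      moreover have "(\<Sum>j < 3. length (P j)) < (\<Sum>j < 3. length ((P(i := P i @ [w])) j))"
        using im(1) by (intro sum_strict_mono_ex1) auto
      ultimately show False by simp
    qed
    have adj: "q ! Suc k \<in> nbrs G (q ! k)" "q ! k \<in> nbrs G (q ! Suc k)" if "k \<le> m" for k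
      using path_nth_adj[OF q(1), of k] nbrs_sym that m by auto
    have wq: "w \<noteq> q ! k" if "k < length q" for k using q(3) zw(2) nth_mem[OF that] by auto
    \<comment> \<open>The spine of the affine diagram: the part of the arm from \<open>v\<close> to
      \<open>z\<close>. At \<open>v\<close> hang the first vertices of the other two arms, at
      \<open>z\<close> hang \<open>w\<close> and the next vertex of the arm. If
      \<open>m = 0\<close>, the spine is \<open>v\<close> alone with four neighbours.\<close>
    define T where "T = (!) q ` {..m}"
    have "2 \<le> graph_spectral_radius G"
    proof (rule two_le_spectral_radius)
      show "T \<noteq> {}" by (simp add: T_def)
      have "T \<subseteq> set q" using m by (auto simp: T_def)
      then show "T \<subseteq> pverts G" using q(3) SV by blast
      fix u assume "u \<in> T"
      then obtain k where k: "k \<le> m" "u = q ! k" by (auto simp: T_def)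
      have T_ge: "length ys \<le> card (nbrs G u \<inter> T)"
        if "distinct ys" "set ys \<subseteq> nbrs G u \<inter> T" for ys
        using that by (metis card_mono distinct_card finite_Int finite_nbrs)
      have feet: "distinct (map (\<lambda>i. P i ! 0) [0..<3])" "set (map (\<lambda>i. P i ! 0) [0..<3]) \<subseteq> nbrs G v"
        using spider_inj[OF P] spider_nbrs[OF P]
        by (auto simp: distinct_map atLeast0LessThan inj_on_def)
      show "4 \<le> card (nbrs G u) + card (nbrs G u \<inter> T)"
      proof (cases k)
        case 0
        then have u: "u = v" using k by (simp add: q_def)
        show ?thesis
        proof (cases "m = 0")
          case True
          then have "z = v" using im by simp
          moreover have "w \<notin> set (map (\<lambda>i. P i ! 0) [0..<3])"
            using zw(2) path(2) by (force simp: S_def)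
          ultimately have "4 \<le> card (nbrs G v)"
            using card_nbrs_ge[of "w # map (\<lambda>i. P i ! 0) [0..<3]" v] feet zw(3) by simp
          then show ?thesis using u by simp
        next
          case False
          have "3 \<le> card (nbrs G u)" using card_nbrs_ge[OF feet] u by simp
          moreover have "1 \<le> card (nbrs G u \<inter> T)"
            using T_ge[of "[q ! 1]"] adj(1)[of 0] False 0 k by (auto simp: T_def)
          ultimately show ?thesis by simp
        qed
      next
        case (Suc k')
        have prev: "q ! k' \<in> nbrs G u \<inter> T" using adj(2)[of k'] Suc k by (auto simp: T_def)
        have nxt: "q ! Suc k \<in> nbrs G u" using adj(1)[of k] k by simp
        have ne: "q ! k' \<noteq> q ! Suc k" using q(2) m k Suc by (simp add: nth_eq_iff_index_eq)
        show ?thesis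
        proof (cases "k = m")
          case True
          then have "w \<in> nbrs G u" using zw(3) im k by (simp add: q_def)
          then have "3 \<le> card (nbrs G u)"
            using card_nbrs_ge[of "[w, q ! k', q ! Suc k]" u] prev nxt ne wq[of k'] wq[of "Suc k"] m k Suc
            by simp
          moreover have "1 \<le> card (nbrs G u \<inter> T)" using T_ge[of "[q ! k']"] prev by simp
          ultimately show ?thesis by simp
        next
          case False
          then have "q ! Suc k \<in> T" using k by (auto simp: T_def)
          then have "2 \<le> card (nbrs G u \<inter> T)"
            using T_ge[of "[q ! k', q ! Suc k]"] prev nxt ne by simp
          moreover have "card (nbrs G u \<inter> T) \<le> card (nbrs G u)" by (simp add: card_mono)
          ultimately show ?thesis by simp
        qed
      qed
    qed
    moreover have "cos (pi / (?n + 1)) < cos 0"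
      by (intro cos_monotone_0_pi) (auto simp: field_simps)
    ultimately show ?thesis by simp
  qed
qed

end

section \<open>Minimisers with the domination number of a path\<close>

lemma (in minimal_graph) ex_hamiltonian_path_if_minimal:
  assumes d: "d = (n + 2) div 3"
  obtains p where "distinct p" "set p = pverts G" "length p = n"
    "\<And>i. Suc i < n \<Longrightarrow> (p ! i, p ! Suc i) \<in> parcs G" "\<And>i. Suc i < n \<Longrightarrow> (p ! Suc i, p ! i) \<in> parcs G"
proof -
  have "graph_spectral_radius G \<le> graph_spectral_radius (path_graph n)"
    using order_pos d connected_path_graph domination_number_path_graph
    by (intro spectral_radius_le_model) auto
  also have "\<dots> \<le> 2 * cos (pi / (card (pverts G) + 1))"
    using spectral_radius_path_graph_le[OF order_pos] card_verts by simp
  \<comment> \<open>A vertex with three neighbours would push the spectral radius above the bound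
    just derived.\<close>
  finally have "card (nbrs G v) \<le> 2" if "v \<in> pverts G" for v
    using spectral_radius_branching[OF that] by linarith
  then obtain p where p: "path p" "set p = pverts G" using ex_hamiltonian_path by blast
  then have len: "length p = n" using card_verts by (metis distinct_card path_def)
  have "(p ! i, p ! Suc i) \<in> parcs G" if "Suc i < n" for i
    using path_nth_adj[OF p(1)] that len by (simp add: nbrs_def)
  then show thesis
    using p len arcs_symmetric by (intro that[of p]) (auto simp: path_def)
qed

lemma (in minimal_graph) isomorphic_path_graph:
  assumes d: "d = (n + 2) div 3"
  shows "graph_isomorphic G (path_graph n)"
proof -
  obtain p where p: "distinct p" "set p = pverts G" "length p = n"
    "\<And>i. Suc i < n \<Longrightarrow> (p ! i, p ! Suc i) \<in> parcs G" "\<And>i. Suc i < n \<Longrightarrow> (p ! Suc i, p ! i) \<in> parcs G"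
    using ex_hamiltonian_path_if_minimal[OF d] by blast
  show ?thesis
    by (rule isomorphic_if_spanning_list[OF _ _ _ p(1,2)])
      (use p(4,5) d order_pos connected_path_graph domination_number_path_graph in
        \<open>auto simp: parcs_path_graph_iff\<close>)
qed

section \<open>Domination number two\<close>

lemma pverts_H_graph [simp]: "pverts (H_graph a b) = {..<a + b}"
  by (simp add: H_graph_def Let_def)

text \<open>One orientation of each edge, so that embedding \<open>H_graph\<close> into a symmetric
  graph needs half the checks.\<close>

definition H_arcs :: "nat \<Rightarrow> nat \<Rightarrow> (nat \<times> nat) set" where
  "H_arcs a b = {(0, 1), (1, 2), (2, 3)} \<union> {0} \<times> {4..<a + 2} \<union> {3} \<times> {a + 2..<a + b}"

lemma parcs_H_graph: "parcs (H_graph a b) = H_arcs a b \<union> (H_arcs a b)\<inverse>"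
  by (simp add: H_graph_def Let_def H_arcs_def)

lemma connected_H_graph:
  assumes "2 \<le> a" "2 \<le> b"
  shows "connected_graph (H_graph a b)"
proof (rule connected_if_smaller_nbr[where n = "a + b", OF pair_graph_H_graph])
  fix v assume v: "0 < v" "v < a + b"
  consider "v = 1" | "v = 2" | "v = 3" | "4 \<le> v" "v < a + 2" | "4 \<le> v" "a + 2 \<le> v" using v by linarith
  then show "\<exists>u < v. (u, v) \<in> parcs (H_graph a b)"
  proof cases
    case 1
    then show ?thesis by (intro exI[of _ 0]) (simp add: H_graph_def Let_def)
  next
    case 2
    then show ?thesis by (intro exI[of _ 1]) (simp add: H_graph_def Let_def)
  next
    case 3
    then show ?thesis by (intro exI[of _ 2]) (simp add: H_graph_def Let_def)
  next
    case 4
    then show ?thesis by (intro exI[of _ 0]) (simp add: H_graph_def Let_def)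
  next
    case 5
    then show ?thesis using v by (intro exI[of _ 3]) (simp add: H_graph_def Let_def)
  qed
qed (use assms in auto)

lemma nbrs_H_graph:
  assumes "2 \<le> a" "2 \<le> b"
  shows "nbrs (H_graph a b) 0 = insert 1 {4..<a + 2}"
    and "nbrs (H_graph a b) 1 = {0, 2}"
    and "nbrs (H_graph a b) 2 = {1, 3}"
    and "nbrs (H_graph a b) 3 = insert 2 {a + 2..<a + b}"
    and "4 \<le> v \<Longrightarrow> v < a + 2 \<Longrightarrow> nbrs (H_graph a b) v = {0}"
    and "4 \<le> v \<Longrightarrow> a + 2 \<le> v \<Longrightarrow> v < a + b \<Longrightarrow> nbrs (H_graph a b) v = {3}"
  using assms by (auto simp: nbrs_def H_graph_def Let_def)

text \<open>The two hubs 0 and 3 dominate everything, and their closed neighbourhoods are disjoint,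
  so no single vertex can dominate both.\<close>

lemma domination_number_H_graph:
  assumes ab: "2 \<le> a" "2 \<le> b"
  shows "domination_number (H_graph a b) = 2"
proof (rule domination_number_eqI)
  show "dominating_set (H_graph a b) {0, 3}"
    unfolding dominating_set_def
  proof (intro conjI ballI)
    fix v assume "v \<in> pverts (H_graph a b) - {0, 3}"
    then consider "v = 1" | "v = 2" | "4 \<le> v" "v < a + 2" | "4 \<le> v" "a + 2 \<le> v" "v < a + b"
      by fastforce
    then show "\<exists>u \<in> {0, 3}. (u, v) \<in> parcs (H_graph a b)"
      by cases (auto simp: H_graph_def Let_def)
  qed (use ab in auto)
  show "2 \<le> card D" if D: "dominating_set (H_graph a b) D" for D
  proof -
    have sym: "u \<in> nbrs (H_graph a b) v" if "(u, v) \<in> parcs (H_graph a b)" for u v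
      using that by (auto simp: nbrs_def H_graph_def Let_def)
    have cover: "\<exists>u \<in> D. u = v \<or> u \<in> nbrs (H_graph a b) v" if "v < a + b" for v
    proof (cases "v \<in> D")
      case False
      then obtain u where "u \<in> D" "(u, v) \<in> parcs (H_graph a b)"
        using D \<open>v < a + b\<close> by (auto simp: dominating_set_def)
      then show ?thesis using sym by blast
    qed blast
    obtain u where u: "u \<in> D" "u = 0 \<or> u \<in> nbrs (H_graph a b) 0" using cover[of 0] ab by auto
    obtain w where w: "w \<in> D" "w = 3 \<or> w \<in> nbrs (H_graph a b) 3" using cover[of 3] ab by auto
    have "u \<noteq> w" using u(2) w(2) nbrs_H_graph(1,4)[OF ab] by auto
    moreover have "finite D" using D by (auto simp: dominating_set_def intro: finite_subset)
    ultimately show ?thesis using u(1) w(1) card_mono[of D "{u, w}"] by simp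
  qed
qed (use card_insert_le_m1 in auto)

text \<open>With \<open>s = sqrt k\<close>, the vector with values \<open>s * (s - 1)\<close> at the
  hubs, \<open>s\<close> at the two middle vertices and \<open>s - 1\<close> at the leaves solves
  the eigenvalue equation for \<open>s\<close> away from the hubs. At the hubs it is a supersolution
  because \<open>s\<close> is at least 2, which is where \<open>4 \<le> k\<close> enters.\<close>

lemma spectral_radius_H_graph:
  assumes ab: "2 \<le> a" "2 \<le> b" and k: "a \<le> k" "b \<le> k" "4 \<le> k"
  shows "graph_spectral_radius (H_graph a b) \<le> sqrt k"
    and "a < k \<Longrightarrow> graph_spectral_radius (H_graph a b) < sqrt k"
proof -
  interpret H: connected_graph "H_graph a b" using ab by (rule connected_H_graph)
  define s where "s = sqrt k"
  have s2: "s * s = k" by (simp add: s_def)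
  have "sqrt 4 \<le> s" unfolding s_def using k(3) by (intro real_sqrt_le_mono) simp
  then have s: "2 \<le> s" by simp
  define f :: "nat \<Rightarrow> real" where
    "f v = (if v = 0 \<or> v = 3 then s * (s - 1) else if v = 1 \<or> v = 2 then s else s - 1)" for v
  have f: "f 0 = s * (s - 1)" "f 3 = s * (s - 1)" "f 1 = s" "f 2 = s" "\<And>v. 4 \<le> v \<Longrightarrow> f v = s - 1"
    by (simp_all add: f_def)
  have leaves: "(\<Sum>u \<in> {c..<d}. f u) = (real d - c) * (s - 1)" if "4 \<le> c" "c \<le> d" for c d
    using that f(5) by (simp add: of_nat_diff)
  have sum0: "(\<Sum>u \<in> nbrs (H_graph a b) 0. f u) = s + (real a - 2) * (s - 1)"
    using leaves[of 4 "a + 2"] ab f(3) by (simp add: nbrs_H_graph(1)[OF ab])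
  have sum3: "(\<Sum>u \<in> nbrs (H_graph a b) 3. f u) = s + (real b - 2) * (s - 1)"
    using leaves[of "a + 2" "a + b"] ab f(4) by (simp add: nbrs_H_graph(4)[OF ab])
  have hub: "s + (real c - 2) * (s - 1) \<le> s * (s * (s - 1))" if "c \<le> k" for c
  proof -
    have "s + (real c - 2) * (s - 1) = real c * (s - 1) + 2 - s" by (simp add: algebra_simps)
    moreover have "real c * (s - 1) \<le> real k * (s - 1)"
      using s that by (intro mult_right_mono) auto
    moreover have "real k * (s - 1) = s * (s * (s - 1))" by (simp add: s2[symmetric])
    ultimately show ?thesis using s by linarith
  qed
  have pos: "0 < f v" for v using s by (simp add: f_def)
  have sup: "(\<Sum>u \<in> nbrs (H_graph a b) v. f u) \<le> s * f v" if v: "v \<in> pverts (H_graph a b)" for v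
  proof -
    consider "v = 0" | "v = 1" | "v = 2" | "v = 3" | "4 \<le> v" "v < a + 2" | "4 \<le> v" "a + 2 \<le> v" by linarith
    then show ?thesis
    proof cases
      case 1
      then show ?thesis using sum0 hub[OF k(1)] f(1) by simp
    next
      case 2
      then show ?thesis
        unfolding 2 nbrs_H_graph(2)[OF ab] using f by (simp add: algebra_simps)
    next
      case 3
      then show ?thesis
        unfolding 3 nbrs_H_graph(3)[OF ab] using f by (simp add: algebra_simps)
    next
      case 4
      then show ?thesis using sum3 hub[OF k(2)] f(2) by simp
    next
      case 5
      then show ?thesis using nbrs_H_graph(5)[OF ab 5] f by simp
    next
      case 6
      then show ?thesis using nbrs_H_graph(6)[OF ab 6] v f by simp
    qed
  qed
  show "graph_spectral_radius (H_graph a b) \<le> sqrt k"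
    unfolding s_def[symmetric] using pos sup by (rule H.spectral_radius_le)
  show "graph_spectral_radius (H_graph a b) < sqrt k" if "a < k"
  proof -
    \<comment> \<open>Since \<open>a < k\<close>, there is room for one more leaf at hub 0; its
      value is the slack.\<close>
    have "(\<Sum>u \<in> nbrs (H_graph a b) 0. f u) + (s - 1) \<le> s * f 0"
      using hub[of "Suc a"] that unfolding sum0 f(1) by (simp add: algebra_simps)
    then have "(\<Sum>u \<in> nbrs (H_graph a b) 0. f u) < s * f 0" using s by simp
    then show ?thesis
      unfolding s_def[symmetric] using H.spectral_radius_less[of f s 0] pos sup ab by simp
  qed
qed

section \<open>Minimisers with domination number two\<close>

context minimal_graph
begin

lemma isomorphic_H_graph_if_list:
  assumes "d = 2" "2 \<le> a" "2 \<le> b" "a + b = n" "distinct vs" "set vs = pverts G"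
    and arcs: "\<And>i j. (i, j) \<in> H_arcs a b \<Longrightarrow> (vs ! i, vs ! j) \<in> parcs G"
  shows "graph_isomorphic G (H_graph a b)"
proof (rule isomorphic_if_spanning_list)
  show "(vs ! i, vs ! j) \<in> parcs G" if "(i, j) \<in> parcs (H_graph a b)" for i j
    using that arcs[of i j] arcs[of j i] arcs_symmetric unfolding parcs_H_graph by blast
qed (use assms connected_H_graph domination_number_H_graph in auto)

text \<open>Some edge \<open>u v\<close> joins the two parts. Because the parts are disjoint closed
  neighbourhoods, \<open>u\<close> is not \<open>x\<close> and \<open>v\<close> is not
  \<open>y\<close>, so \<open>x u v y\<close> is a path and all other vertices hang at
  \<open>x\<close> or at \<open>y\<close>.\<close>

lemma isomorphic_H_graph_if_partition:
  assumes d: "d = 2" and xy: "x \<in> pverts G" "y \<in> pverts G"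
    and un: "insert x (nbrs G x) \<union> insert y (nbrs G y) = pverts G"
    and disj: "insert x (nbrs G x) \<inter> insert y (nbrs G y) = {}"
    and a: "card (insert x (nbrs G x)) = a" and b: "card (insert y (nbrs G y)) = b"
  shows "graph_isomorphic G (H_graph a b)"
proof -
  obtain u v where uv': "u \<in> insert x (nbrs G x)" "v \<in> pverts G - insert x (nbrs G x)" "v \<in> nbrs G u"
    by (rule cut_arc[of "insert x (nbrs G x)"]) (use un disj in auto)
  then have "u \<noteq> x" by blast
  then have ux: "u \<in> nbrs G x" using uv' by blast
  then have "v \<noteq> y" using uv'(3) nbrs_sym[of y u] disj by blast
  then have uv: "u \<in> nbrs G x" "v \<in> nbrs G y" "v \<in> nbrs G u" using ux uv' un by blast+
  obtain xs where xs: "distinct xs" "set xs = nbrs G x - {u}"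
    using finite_distinct_list[of "nbrs G x - {u}"] by auto
  obtain ys where ys: "distinct ys" "set ys = nbrs G y - {v}"
    using finite_distinct_list[of "nbrs G y - {v}"] by auto
  have lx: "length xs + 2 = a"
    using a uv(1) xs distinct_card[OF xs(1)] card_Suc_Diff1[of "nbrs G x" u] by simp
  have ly: "length ys + 2 = b"
    using b uv(2) ys distinct_card[OF ys(1)] card_Suc_Diff1[of "nbrs G y" v] by simp
  have ab: "2 \<le> a" "2 \<le> b" using lx ly by auto
  define vs where "vs = x # u # v # y # xs @ ys"
  have V: "distinct vs" "set vs = pverts G"
    using xs ys uv disj unfolding un[symmetric] by (auto simp: vs_def)
  have n: "a + b = n"
    using distinct_card[OF V(1)] V(2) card_verts lx ly by (simp add: vs_def)
  have vs: "vs ! 0 = x" "vs ! 1 = u" "vs ! 2 = v" "vs ! 3 = y"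
    by (simp_all add: vs_def numeral_2_eq_2 numeral_3_eq_3)
  have vx: "vs ! i \<in> nbrs G x" if "4 \<le> i" "i < a + 2" for i
  proof -
    define j where "j = i - 4"
    have i: "i = Suc (Suc (Suc (Suc j)))" "j < length xs" using that lx by (auto simp: j_def)
    then have "vs ! i = xs ! j" by (simp add: vs_def nth_append)
    then show ?thesis using i(2) xs(2) nth_mem by fastforce
  qed
  have vy: "vs ! i \<in> nbrs G y" if "a + 2 \<le> i" "i < a + b" for i
  proof -
    define j where "j = i - 4 - length xs"
    have i: "i = Suc (Suc (Suc (Suc (length xs + j))))" "j < length ys"
      using that lx ly by (auto simp: j_def)
    then have "vs ! i = ys ! j" by (simp add: vs_def nth_append)
    then show ?thesis using i(2) ys(2) nth_mem by fastforce
  qed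
  have "(vs ! i, vs ! j) \<in> parcs G" if "(i, j) \<in> H_arcs a b" for i j
    using that vx[of j] vy[of j] uv vs nbrs_sym[of v y] by (auto simp: nbrs_def H_arcs_def)
  then show ?thesis using isomorphic_H_graph_if_list d ab n V by blast
qed

lemma isomorphic_H_graph_large:
  assumes d: "d = 2" and n: "7 \<le> n"
  shows "graph_isomorphic G (H_graph (n div 2) ((n + 1) div 2))"
proof -
  define k where "k = (n + 1) div 2"
  define s where "s = sqrt k"
  have k: "4 \<le> k" using n by (simp add: k_def)
  have s: "s * s = k" "0 < s" using k by (simp_all add: s_def)
  have ab: "2 \<le> n div 2" "2 \<le> k" "n div 2 \<le> k" "n div 2 + k = n" using n by (auto simp: k_def)
  have "graph_spectral_radius G \<le> graph_spectral_radius (H_graph (n div 2) k)"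
    using ab d connected_H_graph domination_number_H_graph by (intro spectral_radius_le_model) auto
  then have le: "graph_spectral_radius G \<le> s"
    and less: "n div 2 < k \<Longrightarrow> graph_spectral_radius G < s"
    using spectral_radius_H_graph[OF ab(1,2,3) order_refl k] by (auto simp: s_def)
  have N_subset: "insert x (nbrs G x) \<subseteq> pverts G" if "x \<in> pverts G" for x
    using that nbrs_subset by blast
  have deg: "Suc (card (nbrs G x)) \<le> k" if x: "x \<in> pverts G" for x
  proof (rule ccontr)
    assume "\<not> ?thesis"
    then have big: "k \<le> card (nbrs G x)" by simp
    have "\<not> dominating_set G {x}"
      using domination_number_le[OF pair_finite_verts, of "{x}"] domination d by auto
    then obtain y where y: "y \<in> pverts G" "y \<noteq> x" "y \<notin> nbrs G x"
      using x by (auto simp: dominating_set_def nbrs_def)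
    \<comment> \<open>The Perron vector of a star with \<open>k\<close> leaves, cut off outside the
      neighbourhood of \<open>x\<close>. It is a subsolution for \<open>s\<close> when
      \<open>x\<close> has at least \<open>k\<close> neighbours, and it vanishes at
      \<open>y\<close>, so the spectral radius would exceed \<open>s\<close>.\<close>
    define f where "f v = (if v = x then s else if v \<in> nbrs G x then 1 else 0)" for v
    have "s < graph_spectral_radius G"
    proof (rule spectral_radius_greater_if_zero[where f = f and z = x and y = y])
      have nonneg: "0 \<le> f v" for v using s(2) by (simp add: f_def)
      then show "0 \<le> f v" for v .
      fix v assume "v \<in> pverts G"
      consider "v = x" | "v \<noteq> x" "v \<in> nbrs G x" | "v \<noteq> x" "v \<notin> nbrs G x" by blast
      then show "s * f v \<le> (\<Sum>u \<in> nbrs G v. f u)"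
      proof cases
        case 1
        have "(\<Sum>u \<in> nbrs G x. f u) = (\<Sum>u \<in> nbrs G x. 1)"
          by (intro sum.cong) (auto simp: f_def)
        then show ?thesis using 1 big s(1) by (simp add: f_def)
      next
        case 2
        then have "f x \<le> (\<Sum>u \<in> nbrs G v. f u)"
          using nonneg nbrs_sym by (intro member_le_sum) auto
        then show ?thesis using 2 by (simp add: f_def)
      next
        case 3
        then show ?thesis using nonneg by (simp add: f_def sum_nonneg)
      qed
    qed (use x y s(2) in \<open>auto simp: f_def\<close>)
    then show False using le by simp
  qed
  obtain D where D: "dominating_set G D" "card D = 2"
    using domination_number_attained[OF pair_finite_verts] domination d by metis
  then obtain x y where xy: "D = {x, y}" "x \<noteq> y" by (meson card_2_iff)
  have V: "x \<in> pverts G" "y \<in> pverts G" using D xy by (auto simp: dominating_set_def)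
  let ?X = "insert x (nbrs G x)" and ?Y = "insert y (nbrs G y)"
  have un: "?X \<union> ?Y = pverts G"
    using D xy N_subset[OF V(1)] N_subset[OF V(2)] by (auto simp: dominating_set_def nbrs_def)
  have cards: "card ?X \<le> k" "card ?Y \<le> k" using deg V by simp_all
  have sum: "card ?X + card ?Y = n + card (?X \<inter> ?Y)"
    using card_Un_Int[of ?X ?Y] un card_verts by simp
  show ?thesis
  proof (cases "?X \<inter> ?Y = {}")
    case True
    then have "card ?X + card ?Y = n" using sum by simp
    \<comment> \<open>Both parts have at most \<open>k\<close> elements and together
      \<open>n\<close>, which leaves only the balanced split.\<close>
    then consider "card ?X = n div 2" "card ?Y = k" | "card ?Y = n div 2" "card ?X = k"
      using cards ab by (cases "card ?X = k") (auto simp: k_def)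
    then show ?thesis
    proof cases
      case 1
      then show ?thesis
        using isomorphic_H_graph_if_partition[OF d V un True 1] by (simp add: k_def)
    next
      case 2
      then show ?thesis
        using isomorphic_H_graph_if_partition[OF d V(2,1) _ _ 2] un True
        by (simp add: k_def Un_commute Int_commute)
    qed
  next
    case False
    then have "card (?X \<inter> ?Y) > 0" by (simp add: card_gt_0_iff)
    \<comment> \<open>The sizes add up to at most \<open>2 * k\<close>, hence to at most
      \<open>n + 1\<close>. An overlap therefore is a single vertex, both neighbourhoods have full
      size, and \<open>n\<close> is odd, so the strict bound on the spectral radius applies.\<close>
    then have c: "card (?X \<inter> ?Y) = 1" "card ?X = k" "card ?Y = k" "n div 2 < k"
      using sum cards ab by auto
    then obtain w where w: "?X \<inter> ?Y = {w}" by (meson card_1_singletonE)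
    have nadj: "x \<notin> nbrs G y" "y \<notin> nbrs G x"
    proof -
      have "\<not> {x, y} \<subseteq> ?X \<inter> ?Y" unfolding w using xy(2) by auto
      then show "x \<notin> nbrs G y" "y \<notin> nbrs G x" using nbrs_sym[of x y] by blast+
    qed
    have "w \<in> ?X \<inter> ?Y" unfolding w by simp
    then have w': "w \<in> nbrs G x" "w \<in> nbrs G y" "w \<noteq> x" "w \<noteq> y" using nadj xy(2) by auto
    \<comment> \<open>A subsolution for \<open>s\<close>: the centres \<open>x\<close> and
      \<open>y\<close> have \<open>k - 1\<close> neighbours, and the value 2 at the shared one lifts
      their sum to \<open>k\<close>. At \<open>w\<close> the two centres contribute
      \<open>2 * s\<close>, and every other vertex sees at least one centre.\<close>
    define f where "f v = (if v = x \<or> v = y then s else if v = w then 2 else 1)" for v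
    have nonneg: "0 \<le> f v" for v using s(2) by (simp add: f_def)
    have hub: "(\<Sum>u \<in> nbrs G z. f u) = s * s"
      if "z = x \<or> z = y" for z
    proof -
      have z: "card (nbrs G z) + 1 = k" "w \<in> nbrs G z" "x \<notin> nbrs G z" "y \<notin> nbrs G z"
        using that c w' nadj by auto
      have "(\<Sum>u \<in> nbrs G z. f u) = (\<Sum>u \<in> nbrs G z. 1 + (if u = w then 1 else 0))"
        using z w' by (intro sum.cong) (auto simp: f_def)
      then show ?thesis using z s by (simp add: sum.distrib)
    qed
    have "s \<le> graph_spectral_radius G"
    proof (rule spectral_radius_ge(1)[where f = f and z = x])
      fix v assume v: "v \<in> pverts G"
      consider "v = x \<or> v = y" | "v = w" | z where "v \<noteq> x" "v \<noteq> y" "v \<noteq> w" "z = x \<or> z = y" "z \<in> nbrs G v"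
        using v nbrs_sym[of v x] nbrs_sym[of v y] unfolding un[symmetric] by blast
      then show "s * f v \<le> (\<Sum>u \<in> nbrs G v. f u)"
      proof cases
        case 1
        then show ?thesis using hub by (auto simp: f_def)
      next
        case 2
        have "(\<Sum>u \<in> {x, y}. f u) \<le> (\<Sum>u \<in> nbrs G v. f u)"
          using w' 2 nbrs_sym[of w x] nbrs_sym[of w y] nonneg by (intro sum_mono2) auto
        then show ?thesis using 2 w' xy(2) by (simp add: f_def)
      next
        case 3
        then have "f z \<le> (\<Sum>u \<in> nbrs G v. f u)" using nonneg by (intro member_le_sum) auto
        then show ?thesis using 3 by (simp add: f_def)
      qed
    qed (use nonneg V s in \<open>auto simp: f_def\<close>)
    then show ?thesis using less c(4) by simp
  qed
qed

end

text \<open>For these orders 2 is the domination number of the path, so a minimiser has a spanning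
  path, and the balanced \<open>H_graph\<close> is itself that path.\<close>

lemma (in minimal_graph) isomorphic_H_graph_small:
  assumes d: "d = 2" and n: "4 \<le> n" "n \<le> 6"
  shows "graph_isomorphic G (H_graph (n div 2) ((n + 1) div 2))"
proof -
  have "d = (n + 2) div 3" using d n by auto
  then obtain p where p: "distinct p" "set p = pverts G" "length p = n"
    "\<And>i. Suc i < n \<Longrightarrow> (p ! i, p ! Suc i) \<in> parcs G" "\<And>i. Suc i < n \<Longrightarrow> (p ! Suc i, p ! i) \<in> parcs G"
    using ex_hamiltonian_path_if_minimal by blast
  have arc: "(p ! i, p ! j) \<in> parcs G" if "j = Suc i" "j < n" for i j
    using p(4)[of i] that by auto
  consider "n = 4" | "n = 5" | "n = 6" using n by linarith
  then show ?thesis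
  proof cases
    case 1
    have "H_arcs 2 2 = {(0, 1), (1, 2), (2, 3)}" by (simp add: H_arcs_def)
    then have "(p ! i, p ! j) \<in> parcs G" if "(i, j) \<in> H_arcs 2 2" for i j
      using that 1 by (intro arc) auto
    then have "graph_isomorphic G (H_graph 2 2)"
      by (intro isomorphic_H_graph_if_list[OF d _ _ _ p(1,2)]) (auto simp: 1)
    then show ?thesis by (simp add: 1)
  next
    case 2
    have "{4..<5} = {4 :: nat}" by auto
    then have "H_arcs 2 3 = {(0, 1), (1, 2), (2, 3), (3, 4)}" by (auto simp: H_arcs_def)
    then have "(p ! i, p ! j) \<in> parcs G" if "(i, j) \<in> H_arcs 2 3" for i j
      using that 2 by (intro arc) auto
    then have "graph_isomorphic G (H_graph 2 3)"
      by (intro isomorphic_H_graph_if_list[OF d _ _ _ p(1,2)]) (auto simp: 2)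
    then show ?thesis by (simp add: 2)
  next
    case 3
    \<comment> \<open>For \<open>n = 6\<close> the path runs through the vertices of
      \<open>H_graph 3 3\<close> in the order 4, 0, 1, 2, 3, 5; the list undoes this
      numbering.\<close>
    define vs where "vs = [p ! 1, p ! 2, p ! 3, p ! 4, p ! 0, p ! 5]"
    have "set vs = (!) p ` {0, 1, 2, 3, 4, 5}" by (auto simp: vs_def)
    also have "{0, 1, 2, 3, 4, 5} = {..<length p}" using p(3) 3 by auto
    also have "(!) p ` \<dots> = set p" by (auto simp: set_conv_nth)
    finally have vs: "distinct vs" "set vs = pverts G"
      using p(1,2,3) 3 by (simp_all add: vs_def nth_eq_iff_index_eq)
    have "{4..<5} = {4 :: nat}" "{5..<6} = {5 :: nat}" by auto
    then have "H_arcs 3 3 = {(0, 1), (1, 2), (2, 3), (0, 4), (3, 5)}" by (auto simp: H_arcs_def)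
    then have "(vs ! i, vs ! j) \<in> parcs G" if "(i, j) \<in> H_arcs 3 3" for i j
      using that 3 arc[of 2 1] arc[of 3 2] arc[of 4 3] arc[of 5 4] p(5)[of 0] by (auto simp: vs_def)
    then have "graph_isomorphic G (H_graph 3 3)"
      by (intro isomorphic_H_graph_if_list[OF d _ _ _ vs]) (auto simp: 3)
    then show ?thesis by (simp add: 3)
  qed
qed

section \<open>Floors, ceilings and the union of the three cases\<close>

lemma nat_floor_half: "nat \<lfloor>real n / 2\<rfloor> = n div 2"
  by (simp add: floor_divide_of_nat_eq[of n 2, simplified])

lemma nat_ceiling_divide:
  assumes "0 < k"
  shows "nat \<lceil>real n / real k\<rceil> = (n + k - 1) div k"
proof -
  define m where "m = (n + k - 1) div k"
  have "k * m \<le> n + k - 1" "n + k - 1 < k * Suc m"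
    using assms by (simp_all add: m_def dividend_less_times_div)
  then have "k * m < n + k" "n \<le> k * m" using assms by auto
  then have "real k * real m < real n + real k" "real n \<le> real k * real m"
    by (simp_all only: flip: of_nat_mult of_nat_add)
  then have "\<lceil>real n / real k\<rceil> = int m"
    using assms by (intro ceiling_unique) (simp_all add: field_simps)
  then show ?thesis by (simp add: m_def)
qed

theorem theorem3p1:
  fixes G :: "'a pair_pre_digraph" and n \<gamma> :: nat
  assumes "G \<in> graphs_order_domination n \<gamma>"
    and "\<forall>H \<in> (graphs_order_domination n \<gamma> :: 'a pair_pre_digraph set).
           graph_spectral_radius G \<le> graph_spectral_radius H"
  shows "(\<gamma> = 1 \<longrightarrow> graph_isomorphic G (star_graph n)) \<and>
         (\<gamma> = 2 \<and> n \<ge> 4 \<longrightarrow>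
            graph_isomorphic G (H_graph (nat \<lfloor>real n / 2\<rfloor>) (nat \<lceil>real n / 2\<rceil>))) \<and>
         (\<gamma> = nat \<lceil>real n / 3\<rceil> \<longrightarrow> graph_isomorphic G (path_graph n))"
proof -
  interpret minimal_graph G n \<gamma> using assms by unfold_locales auto
  show ?thesis
    using nat_floor_half[of n] nat_ceiling_divide[of 2 n] nat_ceiling_divide[of 3 n]
      isomorphic_star_graph isomorphic_path_graph isomorphic_H_graph_small isomorphic_H_graph_large
    by (cases "n \<le> 6") auto
qed

end
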